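(* Let $S=Z(f)$ be a $(2,2)$-type surface of $\mathbb{P}^1\times\mathbb{P}^2$. If $S$ has at most $A_1$-type singularities, then $S$ is a semi-stable surface.
   Context: Work over $\mathbb{C}$. A $(2,2)$-type surface is an effective divisor $S=Z(f)$ of $\mathbb{P}^1\times\mathbb{P}^2$, where $0\neq f\in V=\mathbb{C}[x_0,x_1]_2\otimes\mathbb{C}[y_0,y_1,y_2]_2$. $G=\mathrm{SL}(2,\mathbb{C})\times\mathrm{SL}(3,\mathbb{C})$ acts linearly on $V$. $S=Z(f)$ is semi-stable if $0\notin\overline{G\cdot f}$; equivalently (Hilbert–Mumford), there is no one-parameter subgroup $\lambda$ of $G$ with $\lim_{t\to0}\lambda(t)\cdot f=0$. A point $P\in S$ is an $A_n$-type singularity if $\widehat{\mathcal{O}}_{S,P}\cong\mathbb{C}[[x,y,z]]/(x^2+y^2+z^{n+1})$. "At most $A_1$-type singularities" means every singular point of $S$ (if any) is of $A_1$-type. *)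

theory Defs
  imports
    "HOL-Analysis.Analysis"
    "HOL-Computational_Algebra.Fraction_Field"
    "HOL-Computational_Algebra.Formal_Power_Series"
    "HOL-Algebra.QuotRing"
    "HOL-Algebra.Ideal_Product"
begin

section \<open>Forms of bidegree (2,2), the group action and semi-stability\<close>

text \<open>
  Since the complex field is infinite, a form is identified with its polynomial function on
  \<open>\<complex>\<^sup>2 \<times> \<complex>\<^sup>3\<close>; \<open>forms22\<close> is the image of the tensor product of
  the spaces of quadratic forms in \<open>x\<close> and in \<open>y\<close>.
\<close>

definition forms22 :: "(complex^2 \<Rightarrow> complex^3 \<Rightarrow> complex) set" where
  "forms22 = {f. \<exists>c :: 2 \<Rightarrow> 2 \<Rightarrow> 3 \<Rightarrow> 3 \<Rightarrow> complex. \<forall>x y.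
     f x y = (\<Sum>i\<in>UNIV. \<Sum>j\<in>UNIV. \<Sum>k\<in>UNIV. \<Sum>l\<in>UNIV. c i j k l * (x $ i * x $ j) * (y $ k * y $ l))}"

definition act :: "complex^2^2 \<Rightarrow> complex^3^3 \<Rightarrow> (complex^2 \<Rightarrow> complex^3 \<Rightarrow> complex)
    \<Rightarrow> (complex^2 \<Rightarrow> complex^3 \<Rightarrow> complex)" where
  "act A B f = (\<lambda>x y. f (matrix_inv A *v x) (matrix_inv B *v y))"

definition SL_orbit :: "(complex^2 \<Rightarrow> complex^3 \<Rightarrow> complex)
    \<Rightarrow> (complex^2 \<Rightarrow> complex^3 \<Rightarrow> complex) set" where
  "SL_orbit f = {act A B f | A B. det A = 1 \<and> det B = 1}"

text \<open>
  The closure is taken in the topology of pointwise convergence. On the finite-dimensional space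
  \<open>forms22\<close> (a closed subspace of the space of all functions) this is the usual
  topology of a complex vector space.
\<close>

definition semistable :: "(complex^2 \<Rightarrow> complex^3 \<Rightarrow> complex) \<Rightarrow> bool" where
  "semistable f \<longleftrightarrow> (\<lambda>x y. 0) \<notin> closure (SL_orbit f)"


section \<open>The surface in the standard affine charts\<close>

text \<open>
  \<open>\<complex>[u,v,w]\<close> is the iterated polynomial ring \<open>\<complex>[u][v][w]\<close>, so \<open>w\<close> is the
  outermost variable.
\<close>

type_synonym poly3 = "complex poly poly poly"

definition const3 :: "complex \<Rightarrow> poly3" where
  "const3 c = [:[:[:c:]:]:]"

definition eval3 :: "poly3 \<Rightarrow> complex^3 \<Rightarrow> complex" where
  "eval3 p P = poly (poly (poly p [:[:P $ 3:]:]) [:P $ 2:]) (P $ 1)"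

definition du :: "poly3 \<Rightarrow> poly3" where "du = map_poly (map_poly pderiv)"
definition dv :: "poly3 \<Rightarrow> poly3" where "dv = map_poly pderiv"
definition dw :: "poly3 \<Rightarrow> poly3" where "dw = pderiv"

text \<open>
  The charts \<open>x\<^sub>i = 1\<close> and \<open>y\<^sub>k = 1\<close> of the two projective spaces. Arithmetic in the
  index types \<open>2\<close> and \<open>3\<close> is modular, hence \<open>k\<close>, \<open>k + 1\<close>, \<open>k + 2\<close> are the three
  indices in cyclic order.
\<close>

definition chart2 :: "2 \<Rightarrow> complex \<Rightarrow> complex^2" where
  "chart2 i u = (\<chi> j. if j = i then 1 else u)"

definition chart3 :: "3 \<Rightarrow> complex \<Rightarrow> complex \<Rightarrow> complex^3" where
  "chart3 k v w = (\<chi> l. if l = k then 1 else if l = k + 1 then v else w)"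

definition dehom :: "(complex^2 \<Rightarrow> complex^3 \<Rightarrow> complex) \<Rightarrow> 2 \<Rightarrow> 3 \<Rightarrow> poly3" where
  "dehom f i k = (THE p. \<forall>P. eval3 p P = f (chart2 i (P $ 1)) (chart3 k (P $ 2) (P $ 3)))"

lemma poly_eqI_on_image:
  fixes p q :: "'a :: idom poly"
  assumes "inj c" and "infinite (UNIV :: 'b set)" and "\<And>z :: 'b. poly p (c z) = poly q (c z)"
  shows "p = q"
proof (rule ccontr)
  assume "p \<noteq> q"
  hence "finite {x. poly (p - q) x = 0}"
    by (intro poly_roots_finite) simp
  moreover have "range c \<subseteq> {x. poly (p - q) x = 0}"
    using assms(3) by auto
  ultimately show False
    using assms(1,2) finite_imageD finite_subset by blast
qed

lemma eval3_eqI: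
  assumes "\<And>P. eval3 p P = eval3 q P"
  shows "p = q"
proof -
  have inf: "infinite (UNIV :: complex set)"
    by (rule infinite_UNIV_char_0)
  have "poly (poly (poly p [:[:w:]:]) [:v:]) u = poly (poly (poly q [:[:w:]:]) [:v:]) u" for u v w
    using assms[of "vector [u, v, w]"] by (simp add: eval3_def)
  hence "poly (poly p [:[:w:]:]) [:v:] = poly (poly q [:[:w:]:]) [:v:]" for v w
    using poly_eqI_on_image[of "\<lambda>z. z"] inf by (metis injI)
  hence "poly p [:[:w:]:] = poly q [:[:w:]:]" for w
    by (intro poly_eqI_on_image[OF _ inf, of "\<lambda>z. [:z:]"]) (auto intro: injI)
  thus ?thesis
    by (intro poly_eqI_on_image[OF _ inf, of "\<lambda>z. [:[:z:]:]"]) (auto intro: injI)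
qed

lemma eval3_simps:
  "eval3 (p + q) P = eval3 p P + eval3 q P"
  "eval3 (p * q) P = eval3 p P * eval3 q P"
  "eval3 (const3 c) P = c" "eval3 0 P = 0" "eval3 1 P = 1"
  "eval3 [:[:[:0, 1:]:]:] P = P $ 1" "eval3 [:[:0, 1:]:] P = P $ 2" "eval3 [:0, 1:] P = P $ 3"
  by (simp_all add: eval3_def const3_def)

lemma eval3_sum: "eval3 (sum g A) P = (\<Sum>a\<in>A. eval3 (g a) P)"
  by (induction A rule: infinite_finite_induct) (simp_all add: eval3_simps)

lemma dehom_eval:
  assumes "f \<in> forms22"
  shows "eval3 (dehom f i k) P = f (chart2 i (P $ 1)) (chart3 k (P $ 2) (P $ 3))"
proof -
  obtain c :: "2 \<Rightarrow> 2 \<Rightarrow> 3 \<Rightarrow> 3 \<Rightarrow> complex" where c: "\<And>x y. f x y =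
     (\<Sum>i\<in>UNIV. \<Sum>j\<in>UNIV. \<Sum>k\<in>UNIV. \<Sum>l\<in>UNIV. c i j k l * (x $ i * x $ j) * (y $ k * y $ l))"
    using assms by (auto simp: forms22_def)
  define X :: "2 \<Rightarrow> poly3" where "X j = (if j = i then 1 else [:[:[:0, 1:]:]:])" for j
  define Y :: "3 \<Rightarrow> poly3" where
    "Y l = (if l = k then 1 else if l = k + 1 then [:[:0, 1:]:] else [:0, 1:])" for l
  define p where "p = (\<Sum>i\<in>UNIV. \<Sum>j\<in>UNIV. \<Sum>k\<in>UNIV. \<Sum>l\<in>UNIV.
     const3 (c i j k l) * (X i * X j) * (Y k * Y l))"
  have X: "eval3 (X j) P = chart2 i (P $ 1) $ j" for j P
    by (simp add: X_def chart2_def eval3_simps)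
  have Y: "eval3 (Y l) P = chart3 k (P $ 2) (P $ 3) $ l" for l P
    by (simp add: Y_def chart3_def eval3_simps)
  have p: "\<forall>P. eval3 p P = f (chart2 i (P $ 1)) (chart3 k (P $ 2) (P $ 3))"
    by (simp only: p_def eval3_sum eval3_simps X Y c) simp
  have "\<forall>P. eval3 (dehom f i k) P = f (chart2 i (P $ 1)) (chart3 k (P $ 2) (P $ 3))"
    unfolding dehom_def by (rule theI[of _ p]) (use p in \<open>auto intro: eval3_eqI\<close>)
  thus ?thesis by blast
qed

text \<open>Jacobian criterion for the affine surface with equation \<open>g = 0\<close>.\<close>

definition singular_point :: "poly3 \<Rightarrow> complex^3 \<Rightarrow> bool" where
  "singular_point g P \<longleftrightarrow> eval3 g P = 0 \<and>
     eval3 (du g) P = 0 \<and> eval3 (dv g) P = 0 \<and> eval3 (dw g) P = 0"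


section \<open>Local rings and their completions\<close>

text \<open>The localization of \<open>\<complex>[u,v,w]\<close> at the maximal ideal of the point \<open>P\<close>.\<close>

definition local_ring3 :: "complex^3 \<Rightarrow> poly3 fract ring" where
  "local_ring3 P = \<lparr>carrier = {Fract p q | p q. eval3 q P \<noteq> 0},
     mult = (*), one = 1, zero = 0, add = (+)\<rparr>"

definition local_ring_ideal :: "poly3 \<Rightarrow> complex^3 \<Rightarrow> poly3 fract set" where
  "local_ring_ideal g P = PIdl\<^bsub>local_ring3 P\<^esub> (Fract g 1)"

definition local_ring :: "poly3 \<Rightarrow> complex^3 \<Rightarrow> poly3 fract set ring" where
  "local_ring g P = local_ring3 P Quot local_ring_ideal g P"

definition local_ring_const :: "poly3 \<Rightarrow> complex^3 \<Rightarrow> complex \<Rightarrow> poly3 fract set" where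
  "local_ring_const g P c = local_ring_ideal g P +>\<^bsub>local_ring3 P\<^esub> Fract (const3 c) 1"

text \<open>The maximal ideal of a ring that is known to be local.\<close>

definition nonunits :: "('a, 'b) ring_scheme \<Rightarrow> 'a set" where
  "nonunits R = carrier R - Units R"

primrec ideal_power :: "('a, 'b) ring_scheme \<Rightarrow> 'a set \<Rightarrow> nat \<Rightarrow> 'a set" where
  "ideal_power R I 0 = carrier R"
| "ideal_power R I (Suc n) = ideal_prod R I (ideal_power R I n)"

text \<open>
  The completion is the inverse limit of the rings \<open>R/I\<^sup>n\<close>. Elements of these quotients are
  cosets, and a coset of \<open>I\<^sup>n\<^sup>+\<^sup>1\<close> maps to a coset of \<open>I\<^sup>n\<close> iff it is contained in it.
\<close>

definition completion :: "('a, 'b) ring_scheme \<Rightarrow> 'a set \<Rightarrow> (nat \<Rightarrow> 'a set) ring" where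
  "completion R I =
     \<lparr>carrier = {s. \<forall>n. s n \<in> carrier (R Quot ideal_power R I n) \<and> s (Suc n) \<subseteq> s n},
      mult = (\<lambda>s t n. s n \<otimes>\<^bsub>R Quot ideal_power R I n\<^esub> t n),
      one = (\<lambda>n. \<one>\<^bsub>R Quot ideal_power R I n\<^esub>),
      zero = (\<lambda>n. \<zero>\<^bsub>R Quot ideal_power R I n\<^esub>),
      add = (\<lambda>s t n. s n \<oplus>\<^bsub>R Quot ideal_power R I n\<^esub> t n)\<rparr>"

definition completion_map :: "('a, 'b) ring_scheme \<Rightarrow> 'a set \<Rightarrow> 'a \<Rightarrow> nat \<Rightarrow> 'a set" where
  "completion_map R I a = (\<lambda>n. ideal_power R I n +>\<^bsub>R\<^esub> a)"

definition complete_local_ring :: "poly3 \<Rightarrow> complex^3 \<Rightarrow> (nat \<Rightarrow> poly3 fract set set) ring" where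
  "complete_local_ring g P = completion (local_ring g P) (nonunits (local_ring g P))"

definition complete_local_ring_const ::
    "poly3 \<Rightarrow> complex^3 \<Rightarrow> complex \<Rightarrow> nat \<Rightarrow> poly3 fract set set" where
  "complete_local_ring_const g P c =
     completion_map (local_ring g P) (nonunits (local_ring g P)) (local_ring_const g P c)"


section \<open>Singularities of type A\<close>

text \<open>\<open>\<complex>[[x,y,z]]\<close> is the iterated power series ring \<open>\<complex>[[x]][[y]][[z]]\<close>.\<close>

type_synonym fps3 = "complex fps fps fps"

definition fps3_ring :: "fps3 ring" where
  "fps3_ring = \<lparr>carrier = UNIV, mult = (*), one = 1, zero = 0, add = (+)\<rparr>"

definition A_ideal :: "nat \<Rightarrow> fps3 set" where
  "A_ideal n = PIdl\<^bsub>fps3_ring\<^esub>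
     (fps_const (fps_const fps_X) ^ 2 + fps_const fps_X ^ 2 + fps_X ^ (n + 1))"

definition A_ring :: "nat \<Rightarrow> fps3 set ring" where
  "A_ring n = fps3_ring Quot A_ideal n"

definition A_ring_const :: "nat \<Rightarrow> complex \<Rightarrow> fps3 set" where
  "A_ring_const n c = A_ideal n +>\<^bsub>fps3_ring\<^esub> fps_const (fps_const (fps_const c))"

text \<open>The isomorphism is one of \<open>\<complex>\<close>-algebras.\<close>

definition A_type_singularity :: "nat \<Rightarrow> poly3 \<Rightarrow> complex^3 \<Rightarrow> bool" where
  "A_type_singularity n g P \<longleftrightarrow>
     (\<exists>h \<in> ring_iso (complete_local_ring g P) (A_ring n).
        \<forall>c. h (complete_local_ring_const g P c) = A_ring_const n c)"

text \<open>
  The six standard charts cover the product of the two projective spaces, so every point of the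
  surface is examined. A point lying in several charts is examined in each of them; both
  conditions on the point are independent of the chart.
\<close>

definition at_most_A1_singularities :: "(complex^2 \<Rightarrow> complex^3 \<Rightarrow> complex) \<Rightarrow> bool" where
  "at_most_A1_singularities f \<longleftrightarrow>
     (\<forall>i k P. singular_point (dehom f i k) P \<longrightarrow> A_type_singularity 1 (dehom f i k) P)"

end

theory Submission
  imports Defs "HOL-Computational_Algebra.Polynomial_FPS"
begin

text \<open>
  If \<open>0\<close> lies in the closure of the orbit of \<open>f\<close>, complete pivoting writes the group elements
  that shrink \<open>f\<close> as \<open>L D U\<^sup>-\<^sup>1\<close> with \<open>D\<close> diagonal and \<open>L\<close>, \<open>U\<close> bounded of determinant of
  modulus one. A limit of the \<open>L\<close> is a pair of bases in which all monomials of \<open>f\<close> have positive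
  weight for some real weights summing to zero. Comparing weights, one finds a singular point at
  which the quadratic part of a local equation is degenerate.

  Such a point is not of type \<open>A\<^sub>1\<close>: under an isomorphism of \<open>\<complex>[[x,y,z]]/(x\<^sup>2 + y\<^sup>2 + z\<^sup>2)\<close> with the
  completed local ring of \<open>g = 0\<close>, the generators \<open>x\<close>, \<open>y\<close>, \<open>z\<close> correspond to elements whose
  linear parts \<open>l\<^sub>1\<close>, \<open>l\<^sub>2\<close>, \<open>l\<^sub>3\<close> are linearly independent, and modulo cubes the relation says that
  \<open>l\<^sub>1\<^sup>2 + l\<^sub>2\<^sup>2 + l\<^sub>3\<^sup>2\<close> is a multiple of the quadratic part of \<open>g\<close>, which is therefore
  nondegenerate.
\<close>

section \<open>Restricting the local ring to lines\<close>

text \<open>Elements of the completed local ring are sequences of cosets and cannot be expanded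
  directly. Everything is therefore read through one-variable Taylor series: germs are restricted to
  the lines \<open>P + t *s D\<close>, and membership in a power of the maximal ideal is used only
  through its consequence that low coefficients vanish for every \<open>D\<close>, up to a multiple
  of \<open>g\<close>. This avoids modelling the completion as a quotient of a power series ring. A
  quadratic form is determined by its values, so the family of all lines sees the quadratic part of
  \<open>g\<close>; the ambiguity modulo \<open>g\<close> is harmless in first order because
  \<open>g\<close> has no terms of order below two at a singular point. On the group side the
  diagonal factors need not converge. Only the bases pass to the limit, and the weights are
  logarithms taken from one sufficiently late member of the sequence. Real weights are enough, since
  the case analysis uses nothing but linear inequalities between them.\<close>

definition line :: "complex^3 \<Rightarrow> complex^3 \<Rightarrow> poly3 \<Rightarrow> complex poly" where
  "line P D p = poly (map_poly (\<lambda>q. poly (map_poly (\<lambda>r. pcompose r [:P $ 1, D $ 1:]) q)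
     [:P $ 2, D $ 2:]) p) [:P $ 3, D $ 3:]"

lemma poly_map_poly_pcompose:
  "poly (poly (map_poly (\<lambda>r. pcompose r a) q) b) t = poly (poly q [:poly b t:]) (poly a (t::complex))"
  by (induction q) (simp_all add: map_poly_pCons poly_pcompose)

lemma poly_line: "poly (line P D p) t = eval3 p (P + t *s D)"
  unfolding line_def eval3_def
  by (induction p) (simp_all add: map_poly_pCons poly_map_poly_pcompose algebra_simps)

lemma line_eqI: "(\<And>t. eval3 p (P + t *s D) = poly q t) \<Longrightarrow> line P D p = q"
  by (intro poly_eqI_on_image[of "\<lambda>t. t"]) (simp_all add: poly_line infinite_UNIV_char_0)

lemma line_mult: "line P D (p * q) = line P D p * line P D q"
  by (rule line_eqI) (simp add: eval3_simps poly_line)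

lemma line_add: "line P D (p + q) = line P D p + line P D q"
  by (rule line_eqI) (simp add: eval3_simps poly_line)

lemma line_const3: "line P D (const3 c) = [:c:]"
  by (rule line_eqI) (simp add: eval3_simps)

lemma line_1 [simp]: "line P D 1 = 1"
  by (rule line_eqI) (simp add: eval3_simps)

lemma coeff_line_0 [simp]: "coeff (line P D p) 0 = eval3 p P"
  using poly_line[of P D p 0] by (simp add: poly_0_coeff_0)

text \<open>Chain rule for one layer of the iterated polynomial ring: \<open>h\<close> restricts the
  coefficients to the line and \<open>b\<close> is substituted for the variable, each contributing
  one term. Nesting it peels off the variables one at a time.\<close>

lemma pderiv_poly_map_poly:
  fixes h :: "'a :: idom \<Rightarrow> complex poly"
  assumes "h 0 = 0" "\<And>x y. h (x + y) = h x + h y" "f 0 = 0"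
    and "\<And>x. pderiv (h x) = h' x" "h' 0 = 0"
  shows "pderiv (poly (map_poly h q) b) =
     poly (map_poly h' q) b + pderiv b * poly (map_poly h (pderiv q)) b"
proof (induction q)
  case (pCons a q)
  have add: "poly (map_poly h (p + q)) b = poly (map_poly h p) b + poly (map_poly h q) b" for p q
  proof -
    have "map_poly h (p + q) = map_poly h p + map_poly h q"
      by (rule poly_eqI) (simp add: coeff_map_poly assms)
    thus ?thesis by simp
  qed
  show ?case
    using pCons assms
    by (simp add: map_poly_pCons pderiv_add pderiv_mult pderiv_pCons add algebra_simps)
qed simp

lemma pderiv_line:
  "pderiv (line P D p) = smult (D $ 1) (line P D (du p)) + smult (D $ 2) (line P D (dv p))
     + smult (D $ 3) (line P D (dw p))"
proof -
  define h1 where "h1 r = pcompose r [:P $ 1, D $ 1:]" for r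
  define h2 where "h2 q = poly (map_poly h1 q) [:P $ 2, D $ 2:]" for q
  have line: "line P D p = poly (map_poly h2 p) [:P $ 3, D $ 3:]" for p
    unfolding line_def h2_def h1_def ..
  have h1: "h1 0 = 0" "h1 (x + y) = h1 x + h1 y" "pderiv (h1 x) = smult (D $ 1) (h1 (pderiv x))" for x y
    by (simp_all add: h1_def pcompose_add pderiv_pcompose pderiv_pCons)
  have ext: "map_poly f (map_poly g q) = map_poly (\<lambda>x. f (g x)) q"
    if "f 0 = 0" "g 0 = 0" for f :: "'a::zero \<Rightarrow> 'b::zero" and g :: "'c::zero \<Rightarrow> 'a" and q
    using that by (intro poly_eqI) (simp add: coeff_map_poly)
  have sm: "poly (map_poly (\<lambda>x. smult c (f x)) q) b = smult c (poly (map_poly f q) b)"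
    if "f 0 = 0" for c :: complex and f :: "'a::zero \<Rightarrow> complex poly" and b q
    using that by (induction q) (simp_all add: map_poly_pCons smult_add_right)
  have h2: "h2 0 = 0" "h2 (x + y) = h2 x + h2 y" for x y
  proof -
    have "map_poly h1 (x + y) = map_poly h1 x + map_poly h1 y"
      by (rule poly_eqI) (simp add: coeff_map_poly h1)
    thus "h2 (x + y) = h2 x + h2 y" by (simp add: h2_def)
  qed (simp add: h2_def)
  have d2: "pderiv (h2 q) = smult (D $ 1) (h2 (map_poly pderiv q)) + smult (D $ 2) (h2 (pderiv q))" for q
    unfolding h2_def
    by (subst pderiv_poly_map_poly[where f = "\<lambda>x. x", OF h1(1,2) _ h1(3)])
       (simp_all add: h1 sm pderiv_pCons ext)
  have add: "poly (map_poly (\<lambda>x. f x + g x) q) b = poly (map_poly f q) b + poly (map_poly g q) b"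
    if "f 0 = 0" "g 0 = 0" for f g :: "'a::zero \<Rightarrow> complex poly" and b q
  proof -
    have "map_poly (\<lambda>x. f x + g x) q = map_poly f q + map_poly g q"
      using that by (intro poly_eqI) (simp add: coeff_map_poly)
    thus ?thesis by simp
  qed
  show ?thesis
    unfolding line
    by (subst pderiv_poly_map_poly[where f = "\<lambda>x. x", OF h2(1,2) _ d2])
       (simp_all add: h2 sm add pderiv_pCons ext du_def dv_def dw_def)
qed

lemma coeff_line_1:
  "coeff (line P D p) 1 = D $ 1 * eval3 (du p) P + D $ 2 * eval3 (dv p) P + D $ 3 * eval3 (dw p) P"
proof -
  have "coeff (line P D p) 1 = coeff (pderiv (line P D p)) 0"
    by (simp add: coeff_pderiv)
  thus ?thesis
    by (simp add: pderiv_line)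
qed

section \<open>Taylor series of germs along lines\<close>

definition jet :: "complex^3 \<Rightarrow> complex^3 \<Rightarrow> poly3 fract \<Rightarrow> complex fps" where
  "jet P D r = (THE j. \<exists>p q. r = Fract p q \<and> eval3 q P \<noteq> 0 \<and>
     j = fps_of_poly (line P D p) * inverse (fps_of_poly (line P D q)))"

text \<open>The choice of fraction does not matter: \<open>p * q' = p' * q\<close> persists after
  restriction to the line, and a denominator that is nonzero at \<open>P\<close> restricts to an
  invertible power series.\<close>

lemma jet_Fract:
  assumes "eval3 q P \<noteq> 0"
  shows "jet P D (Fract p q) = fps_of_poly (line P D p) * inverse (fps_of_poly (line P D q))"
  unfolding jet_def
proof (rule the_equality)
  show "\<exists>p' q'. Fract p q = Fract p' q' \<and> eval3 q' P \<noteq> 0 \<and>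
     fps_of_poly (line P D p) * inverse (fps_of_poly (line P D q)) =
     fps_of_poly (line P D p') * inverse (fps_of_poly (line P D q'))"
    using assms by blast
next
  fix j assume "\<exists>p' q'. Fract p q = Fract p' q' \<and> eval3 q' P \<noteq> 0 \<and>
     j = fps_of_poly (line P D p') * inverse (fps_of_poly (line P D q'))"
  then obtain p' q' where *: "Fract p q = Fract p' q'" "eval3 q' P \<noteq> 0"
     "j = fps_of_poly (line P D p') * inverse (fps_of_poly (line P D q'))" by blast
  have "q \<noteq> 0" "q' \<noteq> 0" using assms *(2) by (auto simp: eval3_simps)
  hence "p * q' = p' * q" using *(1) by (simp add: eq_fract)
  hence "line P D p * line P D q' = line P D p' * line P D q" by (metis line_mult)
  hence eq: "fps_of_poly (line P D p) * fps_of_poly (line P D q') =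
      fps_of_poly (line P D p') * fps_of_poly (line P D q)" by (metis fps_of_poly_mult)
  have inv: "inverse (fps_of_poly (line P D q)) * fps_of_poly (line P D q) = 1"
    "inverse (fps_of_poly (line P D q')) * fps_of_poly (line P D q') = 1"
    by (rule inverse_mult_eq_1; use assms *(2) in simp)+
  have frac_eq: "a * i = a' * i'" if "i * b = 1" "i' * b' = 1" "a * b' = a' * b"
    for a b i a' b' i' :: "complex fps"
  proof -
    have "a * i = (a * b') * (i * i')" using that(2) by (simp add: ac_simps)
    also have "\<dots> = a' * i' * (i * b)" unfolding that(3) by (simp add: ac_simps)
    finally show ?thesis using that(1) by simp
  qed
  show "j = fps_of_poly (line P D p) * inverse (fps_of_poly (line P D q))"
    using frac_eq[OF inv eq] *(3) by simp
qed

lemma local_ring3_carrier: "carrier (local_ring3 P) = {Fract p q | p q. eval3 q P \<noteq> 0}"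
  and local_ring3_simps [simp]: "mult (local_ring3 P) = (*)" "add (local_ring3 P) = (+)"
    "one (local_ring3 P) = 1" "zero (local_ring3 P) = 0"
  by (simp_all add: local_ring3_def)

lemma local_ring3E:
  assumes "r \<in> carrier (local_ring3 P)"
  obtains p q where "r = Fract p q" "eval3 q P \<noteq> 0" "q \<noteq> 0"
proof -
  obtain p q where "r = Fract p q" "eval3 q P \<noteq> 0"
    using assms by (auto simp: local_ring3_carrier)
  moreover from this have "q \<noteq> 0" by (auto simp: eval3_simps)
  ultimately show ?thesis by (rule that)
qed

lemma Fract_in_local_ring3: "eval3 q P \<noteq> 0 \<Longrightarrow> Fract p q \<in> carrier (local_ring3 P)"
  by (auto simp: local_ring3_carrier)

lemma cring_local_ring3: "cring (local_ring3 P)"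
proof (intro cringI abelian_groupI comm_monoidI)
  fix x y assume *: "x \<in> carrier (local_ring3 P)" "y \<in> carrier (local_ring3 P)"
  obtain a b where x: "x = Fract a b" "eval3 b P \<noteq> 0" "b \<noteq> 0" using *(1) by (rule local_ring3E)
  obtain c d where y: "y = Fract c d" "eval3 d P \<noteq> 0" "d \<noteq> 0" using *(2) by (rule local_ring3E)
  show "x \<oplus>\<^bsub>local_ring3 P\<^esub> y \<in> carrier (local_ring3 P)"
    using x y by (simp add: Fract_in_local_ring3 eval3_simps)
  show "x \<otimes>\<^bsub>local_ring3 P\<^esub> y \<in> carrier (local_ring3 P)"
    using x y by (simp add: Fract_in_local_ring3 eval3_simps)
next
  fix x assume "x \<in> carrier (local_ring3 P)"
  then obtain a b where x: "x = Fract a b" "eval3 b P \<noteq> 0" "b \<noteq> 0" by (rule local_ring3E)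
  have "- x \<in> carrier (local_ring3 P)" using x by (simp add: Fract_in_local_ring3)
  thus "\<exists>y\<in>carrier (local_ring3 P). y \<oplus>\<^bsub>local_ring3 P\<^esub> x = \<zero>\<^bsub>local_ring3 P\<^esub>"
    by (intro bexI[of _ "- x"]) simp_all
qed (auto simp: algebra_simps Zero_fract_def One_fract_def eval3_simps
       intro!: Fract_in_local_ring3)

lemma jet_const3: "jet P D (Fract (const3 c) 1) = fps_const c"
  by (simp add: jet_Fract eval3_simps line_const3 fps_of_poly_const)

lemma jet_Fract_1: "jet P D (Fract p 1) = fps_of_poly (line P D p)"
  by (simp add: jet_Fract eval3_simps)

lemma jet_mult:
  assumes "r \<in> carrier (local_ring3 P)" "s \<in> carrier (local_ring3 P)"
  shows "jet P D (r * s) = jet P D r * jet P D s"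
proof -
  obtain a b where x: "r = Fract a b" "eval3 b P \<noteq> 0" "b \<noteq> 0" using assms(1) by (rule local_ring3E)
  obtain c d where y: "s = Fract c d" "eval3 d P \<noteq> 0" "d \<noteq> 0" using assms(2) by (rule local_ring3E)
  show ?thesis
    using x y by (simp add: jet_Fract eval3_simps line_mult fps_of_poly_mult fps_inverse_mult)
qed

lemma jet_add:
  assumes "r \<in> carrier (local_ring3 P)" "s \<in> carrier (local_ring3 P)"
  shows "jet P D (r + s) = jet P D r + jet P D s"
proof -
  obtain a b where x: "r = Fract a b" "eval3 b P \<noteq> 0" "b \<noteq> 0" using assms(1) by (rule local_ring3E)
  obtain c d where y: "s = Fract c d" "eval3 d P \<noteq> 0" "d \<noteq> 0" using assms(2) by (rule local_ring3E)
  have inv: "inverse (fps_of_poly (line P D b)) * fps_of_poly (line P D b) = 1"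
    "inverse (fps_of_poly (line P D d)) * fps_of_poly (line P D d) = 1"
    by (rule inverse_mult_eq_1; use x y in simp)+
  have frac_add: "(a * d + c * b) * (i * j) = a * i + c * j" if "i * b = 1" "j * d = 1"
    for a b c d i j :: "complex fps"
  proof -
    have "(a * d + c * b) * (i * j) = a * i * (j * d) + c * j * (i * b)" by (simp add: algebra_simps)
    thus ?thesis using that by simp
  qed
  have "jet P D (r + s) = (fps_of_poly (line P D a) * fps_of_poly (line P D d) +
      fps_of_poly (line P D c) * fps_of_poly (line P D b)) *
      (inverse (fps_of_poly (line P D b)) * inverse (fps_of_poly (line P D d)))"
    using x y by (simp add: jet_Fract eval3_simps line_mult line_add fps_of_poly_add fps_of_poly_mult fps_inverse_mult)
  also have "\<dots> = jet P D r + jet P D s"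
    unfolding x y jet_Fract[OF x(2)] jet_Fract[OF y(2)] by (rule frac_add[OF inv])
  finally show ?thesis .
qed

lemma jet_diff:
  assumes "r \<in> carrier (local_ring3 P)" "s \<in> carrier (local_ring3 P)"
  shows "r - s \<in> carrier (local_ring3 P)" "jet P D (r - s) = jet P D r - jet P D s"
proof -
  obtain a b where x: "r = Fract a b" "eval3 b P \<noteq> 0" "b \<noteq> 0" using assms(1) by (rule local_ring3E)
  obtain c d where y: "s = Fract c d" "eval3 d P \<noteq> 0" "d \<noteq> 0" using assms(2) by (rule local_ring3E)
  show *: "r - s \<in> carrier (local_ring3 P)"
    using x y by (simp add: Fract_in_local_ring3 eval3_simps)
  show "jet P D (r - s) = jet P D r - jet P D s"
    using jet_add[OF * assms(2), of D] by simp
qed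

lemma jet_0: "fps_nth (jet P D r) 0 = fps_nth (jet P D' r) 0" if "r \<in> carrier (local_ring3 P)"
  using that by (auto elim!: local_ring3E simp: jet_Fract)

text \<open>The first-order coefficient is the differential of the germ applied to \<open>D\<close>.
  Having one vector \<open>L\<close> for all \<open>D\<close> allows the first-order parts of three
  germs to be assembled into a matrix.\<close>

lemma jet_1_linear:
  assumes "r \<in> carrier (local_ring3 P)"
  obtains L :: "complex^3" where "\<And>D. fps_nth (jet P D r) 1 = L $ 1 * D $ 1 + L $ 2 * D $ 2 + L $ 3 * D $ 3"
proof -
  obtain p q where r: "r = Fract p q" "eval3 q P \<noteq> 0" "q \<noteq> 0" using assms by (rule local_ring3E)
  define c where "c = eval3 p P / eval3 q P"
  \<comment> \<open>Quotient rule for the gradient of \<open>p / q\<close> at \<open>P\<close>,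
    where \<open>c\<close> is the value of the germ.\<close>
  define L :: "complex^3" where "L = vector [(eval3 (du p) P - c * eval3 (du q) P) / eval3 q P,
    (eval3 (dv p) P - c * eval3 (dv q) P) / eval3 q P, (eval3 (dw p) P - c * eval3 (dw q) P) / eval3 q P]"
  have "fps_nth (jet P D r) 1 = L $ 1 * D $ 1 + L $ 2 * D $ 2 + L $ 3 * D $ 3" for D
  proof -
    have inv: "inverse (fps_of_poly (line P D q)) * fps_of_poly (line P D q) = 1"
      by (rule inverse_mult_eq_1) (use r in simp)
    have "jet P D r * fps_of_poly (line P D q) = fps_of_poly (line P D p)"
      using inv by (simp add: r jet_Fract mult.assoc)
    hence "fps_nth (jet P D r * fps_of_poly (line P D q)) 1 = coeff (line P D p) 1"
      by (simp only: fps_of_poly_nth)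
    moreover have "fps_nth (jet P D r) 0 = c"
      using r by (simp add: jet_Fract c_def divide_inverse)
    ultimately have "fps_nth (jet P D r) 1 * eval3 q P + c * coeff (line P D q) 1 = coeff (line P D p) 1"
      by (simp add: fps_mult_nth_1 add.commute)
    hence "fps_nth (jet P D r) 1 = (coeff (line P D p) 1 - c * coeff (line P D q) 1) / eval3 q P"
      using r(2) by (simp add: field_simps)
    thus ?thesis
      using r(2) unfolding coeff_line_1 L_def
      by (simp add: add_divide_distrib diff_divide_distrib algebra_simps)
  qed
  thus ?thesis by (rule that)
qed

section \<open>Taylor expansions of elements of the completed local ring\<close>

lemma Fract_1_in_local_ring3 [simp]: "Fract p 1 \<in> carrier (local_ring3 P)"
  by (rule Fract_in_local_ring3) (simp add: eval3_simps)

lemma zero_in_local_ring3 [simp]: "0 \<in> carrier (local_ring3 P)"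
  by (simp add: Zero_fract_def)

lemma one_in_local_ring3 [simp]: "1 \<in> carrier (local_ring3 P)"
  by (simp add: One_fract_def)

lemma ideal_local_ring_ideal: "ideal (local_ring_ideal g P) (local_ring3 P)"
  unfolding local_ring_ideal_def
  by (intro cring.cgenideal_ideal cring_local_ring3) simp

lemma local_ring_ideal_eq:
  "local_ring_ideal g P = {x * Fract g 1 | x. x \<in> carrier (local_ring3 P)}"
  by (simp add: local_ring_ideal_def cgenideal_def)

lemma cring_local_ring: "cring (local_ring g P)"
  unfolding local_ring_def
  by (rule ideal.quotient_is_cring[OF ideal_local_ring_ideal cring_local_ring3])

text \<open>Elements of \<open>(g) + \<mm>\<^sup>n\<close>, detected on all lines through \<open>P\<close>.\<close>

definition vanishes_mod :: "poly3 \<Rightarrow> complex^3 \<Rightarrow> nat \<Rightarrow> poly3 fract \<Rightarrow> bool" where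
  "vanishes_mod g P n r \<longleftrightarrow> r \<in> carrier (local_ring3 P) \<and>
     (\<exists>x \<in> carrier (local_ring3 P). \<forall>D. \<forall>k<n. fps_nth (jet P D (r - x * Fract g 1)) k = 0)"

lemma local_ring3_closed:
  assumes "r \<in> carrier (local_ring3 P)" "s \<in> carrier (local_ring3 P)"
  shows "r + s \<in> carrier (local_ring3 P)" "r * s \<in> carrier (local_ring3 P)"
proof -
  interpret cring "local_ring3 P" by (rule cring_local_ring3)
  show "r + s \<in> carrier (local_ring3 P)" "r * s \<in> carrier (local_ring3 P)"
    using add.m_closed[OF assms] m_closed[OF assms] by simp_all
qed

lemma vanishes_mod_add_ideal:
  assumes "vanishes_mod g P n r" "x \<in> carrier (local_ring3 P)"
  shows "vanishes_mod g P n (x * Fract g 1 + r)"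
proof -
  obtain y where y: "r \<in> carrier (local_ring3 P)" "y \<in> carrier (local_ring3 P)"
    "\<And>D k. k < n \<Longrightarrow> fps_nth (jet P D (r - y * Fract g 1)) k = 0"
    using assms by (auto simp: vanishes_mod_def)
  have "x * Fract g 1 + r - (x + y) * Fract g 1 = r - y * Fract g 1"
    by (simp add: ring_distribs)
  with y(3) have "\<forall>D. \<forall>k<n. fps_nth (jet P D (x * Fract g 1 + r - (x + y) * Fract g 1)) k = 0"
    by (simp only:) simp
  thus ?thesis
    unfolding vanishes_mod_def using y(1,2) assms(2)
    by (intro conjI bexI[of _ "x + y"]) (auto intro!: local_ring3_closed)
qed

lemma vanishes_mod_add:
  assumes "vanishes_mod g P n r" "vanishes_mod g P n s"
  shows "vanishes_mod g P n (r + s)"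
proof -
  obtain x where x: "r \<in> carrier (local_ring3 P)" "x \<in> carrier (local_ring3 P)"
    "\<And>D k. k < n \<Longrightarrow> fps_nth (jet P D (r - x * Fract g 1)) k = 0"
    using assms by (auto simp: vanishes_mod_def)
  obtain y where y: "s \<in> carrier (local_ring3 P)" "y \<in> carrier (local_ring3 P)"
    "\<And>D k. k < n \<Longrightarrow> fps_nth (jet P D (s - y * Fract g 1)) k = 0"
    using assms by (auto simp: vanishes_mod_def)
  have eq: "r + s - (x + y) * Fract g 1 = (r - x * Fract g 1) + (s - y * Fract g 1)"
    by (simp add: algebra_simps)
  moreover have "\<forall>D. \<forall>k<n. fps_nth (jet P D ((r - x * Fract g 1) + (s - y * Fract g 1))) k = 0"
    using x y by (subst jet_add) (auto intro!: jet_diff local_ring3_closed)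
  ultimately have "\<forall>D. \<forall>k<n. fps_nth (jet P D (r + s - (x + y) * Fract g 1)) k = 0"
    by (simp only: eq)
  thus ?thesis
    unfolding vanishes_mod_def using x(1,2) y(1,2)
    by (intro conjI bexI[of _ "x + y"]) (auto intro!: local_ring3_closed)
qed

text \<open>Subtracting multiples of \<open>g\<close> leaves \<open>r'\<close> without constant term
  and \<open>s'\<close> of order \<open>n\<close>, so every term of their Cauchy product up to
  degree \<open>n\<close> contains a zero factor. The subtracted parts recombine into a multiple of
  \<open>g\<close>.\<close>

lemma vanishes_mod_mult:
  assumes "vanishes_mod g P 1 r" "vanishes_mod g P n s"
  shows "vanishes_mod g P (Suc n) (r * s)"
proof -
  obtain x where x: "r \<in> carrier (local_ring3 P)" "x \<in> carrier (local_ring3 P)"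
    "\<And>D. fps_nth (jet P D (r - x * Fract g 1)) 0 = 0"
    using assms by (auto simp: vanishes_mod_def)
  obtain y where y: "s \<in> carrier (local_ring3 P)" "y \<in> carrier (local_ring3 P)"
    "\<And>D k. k < n \<Longrightarrow> fps_nth (jet P D (s - y * Fract g 1)) k = 0"
    using assms by (auto simp: vanishes_mod_def)
  define r' where "r' = r - x * Fract g 1"
  define s' where "s' = s - y * Fract g 1"
  have c: "r' \<in> carrier (local_ring3 P)" "s' \<in> carrier (local_ring3 P)"
    using x y by (auto simp: r'_def s'_def intro!: jet_diff local_ring3_closed)
  have 0: "fps_nth (jet P D (r' * s')) k = 0" if "k < Suc n" for D k
    unfolding jet_mult[OF c] fps_mult_nth
  proof (rule sum.neutral, rule ballI)
    fix i assume i: "i \<in> {0..k}"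
    show "fps_nth (jet P D r') i * fps_nth (jet P D s') (k - i) = 0"
    proof (cases "i = 0")
      case False
      with that i have "k - i < n" by auto
      thus ?thesis using y(3) by (simp add: s'_def)
    qed (use x(3) in \<open>simp add: r'_def\<close>)
  qed
  have "vanishes_mod g P (Suc n) (r' * s')"
    unfolding vanishes_mod_def using 0 c
    by (intro conjI bexI[of _ 0]) (auto intro!: local_ring3_closed)
  moreover have "r * s = (x * s + y * r') * Fract g 1 + r' * s'"
    by (simp add: r'_def s'_def algebra_simps)
  ultimately show ?thesis
    using vanishes_mod_add_ideal[of g P "Suc n" "r' * s'" "x * s + y * r'"] x y c
    by (auto intro!: local_ring3_closed)
qed

lemma local_ring_coset_mem:
  assumes "r \<in> carrier (local_ring3 P)"
  shows "r' \<in> local_ring_ideal g P +>\<^bsub>local_ring3 P\<^esub> r \<longleftrightarrow>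
    (\<exists>x\<in>carrier (local_ring3 P). r' = x * Fract g 1 + r)"
  by (auto simp: a_r_coset_def' local_ring_ideal_eq)

lemma carrier_local_ring:
  "carrier (local_ring g P) =
     {local_ring_ideal g P +>\<^bsub>local_ring3 P\<^esub> r | r. r \<in> carrier (local_ring3 P)}"
  by (auto simp: local_ring_def FactRing_def A_RCOSETS_def')


abbreviation local_ring_class :: "poly3 \<Rightarrow> complex^3 \<Rightarrow> poly3 fract \<Rightarrow> poly3 fract set" where
  "local_ring_class g P r \<equiv> local_ring_ideal g P +>\<^bsub>local_ring3 P\<^esub> r"

lemma local_ring_class_hom: "local_ring_class g P \<in> ring_hom (local_ring3 P) (local_ring g P)"
  unfolding local_ring_def by (rule ideal.rcos_ring_hom[OF ideal_local_ring_ideal])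

lemma local_ring_class_simps:
  assumes "r \<in> carrier (local_ring3 P)" "s \<in> carrier (local_ring3 P)"
  shows "local_ring_class g P r \<oplus>\<^bsub>local_ring g P\<^esub> local_ring_class g P s = local_ring_class g P (r + s)"
    and "local_ring_class g P r \<otimes>\<^bsub>local_ring g P\<^esub> local_ring_class g P s = local_ring_class g P (r * s)"
  using ring_hom_add[OF local_ring_class_hom assms] ring_hom_mult[OF local_ring_class_hom assms]
  by simp_all

lemma local_ring_class_closed:
  "r \<in> carrier (local_ring3 P) \<Longrightarrow> local_ring_class g P r \<in> carrier (local_ring g P)"
  by (rule ring_hom_closed[OF local_ring_class_hom])

lemma local_ring_class_one: "\<one>\<^bsub>local_ring g P\<^esub> = local_ring_class g P 1"
  using ring_hom_one[OF local_ring_class_hom] by simp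

lemma local_ring_class_zero: "\<zero>\<^bsub>local_ring g P\<^esub> = local_ring_class g P 0"
  using ideal.rcos_ring_hom_ring[OF ideal_local_ring_ideal]
  by (metis local_ring3_simps(4) local_ring_def ring_hom_ring.axioms(1,2) ring_hom_zero local_ring_class_hom)

lemma mem_local_ring_class: "r \<in> carrier (local_ring3 P) \<Longrightarrow> r \<in> local_ring_class g P r"
  by (auto simp: local_ring_coset_mem intro!: bexI[of _ 0])

lemma local_ring_class_eqD:
  assumes "local_ring_class g P r = local_ring_class g P s"
    "r \<in> carrier (local_ring3 P)" "s \<in> carrier (local_ring3 P)"
  obtains x where "x \<in> carrier (local_ring3 P)" "r = x * Fract g 1 + s"
  using mem_local_ring_class[OF assms(2), of g] assms local_ring_coset_mem by blast

text \<open>A germ with nonzero value has a numerator that is nonzero at \<open>P\<close>, so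
  exchanging numerator and denominator stays in the localization and inverts the germ.\<close>

lemma jet_nonunit:
  assumes "local_ring_class g P r \<in> nonunits (local_ring g P)" "r \<in> carrier (local_ring3 P)"
  shows "fps_nth (jet P D r) 0 = 0"
proof (rule ccontr)
  assume *: "fps_nth (jet P D r) 0 \<noteq> 0"
  obtain p q where r: "r = Fract p q" "eval3 q P \<noteq> 0" "q \<noteq> 0"
    using assms(2) by (rule local_ring3E)
  have p: "eval3 p P \<noteq> 0" using * r by (simp add: jet_Fract)
  hence "p \<noteq> 0" by (auto simp: eval3_simps)
  define r' where "r' = Fract q p"
  have r': "r' \<in> carrier (local_ring3 P)" using p by (simp add: r'_def Fract_in_local_ring3)
  have "r * r' = 1" using r \<open>p \<noteq> 0\<close> by (simp add: r'_def One_fract_def eq_fract)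
  hence "local_ring_class g P r \<in> Units (local_ring g P)"
    using assms(2) r' by (auto simp: Units_def local_ring_class_simps local_ring_class_closed local_ring_class_one
      mult.commute intro!: bexI[of _ "local_ring_class g P r'"])
  thus False using assms(1) by (simp add: nonunits_def)
qed

lemma vanishes_mod_minus:
  assumes "vanishes_mod g P n r"
  shows "vanishes_mod g P n (- r)"
proof -
  obtain x where x: "r \<in> carrier (local_ring3 P)" "x \<in> carrier (local_ring3 P)"
    "\<And>D k. k < n \<Longrightarrow> fps_nth (jet P D (r - x * Fract g 1)) k = 0"
    using assms by (auto simp: vanishes_mod_def)
  have neg: "- y \<in> carrier (local_ring3 P)" "jet P D (- y) = - jet P D y"
    if "y \<in> carrier (local_ring3 P)" for y D
  proof -
    have "jet P D 0 = 0" using jet_const3[of P D 0] by (simp add: Zero_fract_def const3_def)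
    thus "- y \<in> carrier (local_ring3 P)" "jet P D (- y) = - jet P D y"
      using jet_diff[OF zero_in_local_ring3 that] by simp_all
  qed
  have "r - x * Fract g 1 \<in> carrier (local_ring3 P)"
    using x by (auto intro!: jet_diff local_ring3_closed)
  from neg(2)[OF this] x(3) have "fps_nth (jet P D (- r - (- x) * Fract g 1)) k = 0" if "k < n" for D k
    using that by simp
  thus ?thesis
    unfolding vanishes_mod_def using x neg by blast
qed

text \<open>The bridge from abstract ideal powers to orders of vanishing: nonunits have order at
  least one, and multiplying and adding, the two ways of generating an ideal product, respect the
  count of orders modulo \<open>g\<close>.\<close>

lemma ideal_power_nonunits:
  assumes "m \<in> ideal_power (local_ring g P) (nonunits (local_ring g P)) n"
  shows "\<exists>r\<in>carrier (local_ring3 P). m = local_ring_class g P r \<and> vanishes_mod g P n r"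
  using assms
proof (induction n arbitrary: m)
  case 0
  thus ?case
    by (auto simp: carrier_local_ring vanishes_mod_def)
next
  case (Suc n)
  from Suc.prems have "m \<in> ideal_prod (local_ring g P) (nonunits (local_ring g P))
      (ideal_power (local_ring g P) (nonunits (local_ring g P)) n)" by simp
  thus ?case
  proof (induction rule: ideal_prod.induct)
    case (prod i j)
    obtain r where r: "r \<in> carrier (local_ring3 P)" "i = local_ring_class g P r"
      using prod(1) by (auto simp: nonunits_def carrier_local_ring)
    obtain s where s: "s \<in> carrier (local_ring3 P)" "j = local_ring_class g P s" "vanishes_mod g P n s"
      using Suc.IH[OF prod(2)] by blast
    have "fps_nth (jet P D r) 0 = 0" for D
      using jet_nonunit r prod(1) by blast
    hence "vanishes_mod g P 1 r"
      using r by (auto simp: vanishes_mod_def intro!: bexI[of _ 0])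
    from vanishes_mod_mult[OF this s(3)] r s show ?case
      by (intro bexI[of _ "r * s"]) (auto simp: local_ring_class_simps local_ring3_closed)
  next
    case (sum s1 s2)
    then obtain r1 r2 where r: "r1 \<in> carrier (local_ring3 P)" "s1 = local_ring_class g P r1"
        "vanishes_mod g P (Suc n) r1" "r2 \<in> carrier (local_ring3 P)" "s2 = local_ring_class g P r2"
        "vanishes_mod g P (Suc n) r2" by blast
    thus ?case
      by (intro bexI[of _ "r1 + r2"])
        (auto simp: local_ring_class_simps local_ring3_closed vanishes_mod_add)
  qed
qed

section \<open>The maximal ideal of the local ring\<close>

lemma nonunits_local_ring:
  assumes "eval3 g P = 0"
  shows "nonunits (local_ring g P) =
    {local_ring_class g P r | r. r \<in> carrier (local_ring3 P) \<and> fps_nth (jet P 0 r) 0 = 0}"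
proof (intro equalityI subsetI)
  fix a assume a: "a \<in> nonunits (local_ring g P)"
  then obtain r where "r \<in> carrier (local_ring3 P)" "a = local_ring_class g P r"
    by (auto simp: nonunits_def carrier_local_ring)
  thus "a \<in> {local_ring_class g P r | r. r \<in> carrier (local_ring3 P) \<and> fps_nth (jet P 0 r) 0 = 0}"
    using jet_nonunit a by blast
next
  fix a assume "a \<in> {local_ring_class g P r | r. r \<in> carrier (local_ring3 P) \<and> fps_nth (jet P 0 r) 0 = 0}"
  then obtain r where r: "r \<in> carrier (local_ring3 P)" "fps_nth (jet P 0 r) 0 = 0"
    and a: "a = local_ring_class g P r" by auto
  \<comment> \<open>An inverse would give \<open>s * r = x * g + 1\<close> for germs; at
    \<open>P\<close> both \<open>r\<close> and \<open>g\<close> vanish, so 0 = 1. Only constant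
    terms are compared, and these do not depend on the direction, so direction \<open>0\<close>
    serves.\<close>
  have "a \<notin> Units (local_ring g P)"
  proof
    assume "a \<in> Units (local_ring g P)"
    then obtain b where b: "b \<in> carrier (local_ring g P)"
      "b \<otimes>\<^bsub>local_ring g P\<^esub> a = \<one>\<^bsub>local_ring g P\<^esub>" by (auto simp: Units_def)
    then obtain s where s: "s \<in> carrier (local_ring3 P)" "b = local_ring_class g P s"
      by (auto simp: carrier_local_ring)
    have "local_ring_class g P (s * r) = local_ring_class g P 1"
      using b r s by (simp add: a local_ring_class_simps local_ring_class_one)
    then obtain x where x: "x \<in> carrier (local_ring3 P)" "s * r = x * Fract g 1 + 1"
      by (rule local_ring_class_eqD) (use r s in \<open>simp_all add: local_ring3_closed\<close>)
    have "jet P 0 1 = 1"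
      using jet_Fract_1[of P 0 1] by (simp add: One_fract_def[symmetric])
    moreover have "jet P 0 (s * r) = jet P 0 x * jet P 0 (Fract g 1) + jet P 0 1"
      using x by (simp add: jet_add jet_mult local_ring3_closed)
    moreover have "jet P 0 (s * r) = jet P 0 s * jet P 0 r"
      using r s by (simp add: jet_mult)
    ultimately have "fps_nth (jet P 0 s * jet P 0 r) 0 = fps_nth (jet P 0 x * jet P 0 (Fract g 1) + 1) 0"
      by simp
    thus False using r assms by (simp add: jet_Fract_1)
  qed
  thus "a \<in> nonunits (local_ring g P)"
    using r a by (simp add: nonunits_def local_ring_class_closed)
qed

lemma ideal_nonunits_local_ring:
  assumes "eval3 g P = 0"
  shows "ideal (nonunits (local_ring g P)) (local_ring g P)"
proof -
  interpret R: cring "local_ring g P" by (rule cring_local_ring)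
  note M = nonunits_local_ring[OF assms]
  have sub: "nonunits (local_ring g P) \<subseteq> carrier (local_ring g P)" by (auto simp: nonunits_def)
  have mult: "a \<otimes>\<^bsub>local_ring g P\<^esub> b \<in> nonunits (local_ring g P)"
    if ab: "a \<in> nonunits (local_ring g P)" "b \<in> carrier (local_ring g P)" for a b
  proof -
    obtain r where r: "r \<in> carrier (local_ring3 P)" "fps_nth (jet P 0 r) 0 = 0" "a = local_ring_class g P r"
      using ab unfolding M by blast
    obtain s where s: "s \<in> carrier (local_ring3 P)" "b = local_ring_class g P s"
      using ab by (auto simp: carrier_local_ring)
    show ?thesis unfolding M using r s
      by (auto simp: local_ring_class_simps local_ring3_closed jet_mult intro!: exI[of _ "r * s"])
  qed
  have add: "a \<oplus>\<^bsub>local_ring g P\<^esub> b \<in> nonunits (local_ring g P)"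
    if ab: "a \<in> nonunits (local_ring g P)" "b \<in> nonunits (local_ring g P)" for a b
  proof -
    obtain r where r: "r \<in> carrier (local_ring3 P)" "fps_nth (jet P 0 r) 0 = 0" "a = local_ring_class g P r"
      using ab unfolding M by blast
    obtain s where s: "s \<in> carrier (local_ring3 P)" "fps_nth (jet P 0 s) 0 = 0" "b = local_ring_class g P s"
      using ab unfolding M by blast
    show ?thesis unfolding M using r s
      by (auto simp: local_ring_class_simps local_ring3_closed jet_add intro!: exI[of _ "r + s"])
  qed
  have "jet P 0 0 = 0" using jet_const3[of P 0 0] by (simp add: Zero_fract_def const3_def)
  hence zero: "\<zero>\<^bsub>local_ring g P\<^esub> \<in> nonunits (local_ring g P)"
    unfolding M local_ring_class_zero by (intro CollectI exI[of _ 0]) simp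
  have minus: "\<ominus>\<^bsub>local_ring g P\<^esub> a \<in> nonunits (local_ring g P)" if "a \<in> nonunits (local_ring g P)" for a
  proof -
    have "\<ominus>\<^bsub>local_ring g P\<^esub> a = a \<otimes>\<^bsub>local_ring g P\<^esub> (\<ominus>\<^bsub>local_ring g P\<^esub> \<one>\<^bsub>local_ring g P\<^esub>)"
      using that sub by (auto simp: R.r_minus)
    thus ?thesis using mult[OF that] by simp
  qed
  show ?thesis
  proof (rule idealI)
    show "subgroup (nonunits (local_ring g P)) (add_monoid (local_ring g P))"
      using sub zero add minus by (intro R.add.subgroupI) (auto simp: a_inv_def)
  qed (use mult sub in \<open>auto simp: R.ring_axioms R.m_comm\<close>)
qed

section \<open>Powers of ideals and arithmetic in the completion\<close>

lemma (in ring) ideal_ideal_power: "ideal I R \<Longrightarrow> ideal (ideal_power R I n) R"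
  by (induction n) (simp_all add: oneideal ideal_prod_is_ideal)

lemma (in ring) ideal_power_Suc_subset: "ideal I R \<Longrightarrow> ideal_power R I (Suc n) \<subseteq> ideal_power R I n"
  using ideal_prod_inter[of I "ideal_power R I n"] ideal_ideal_power[of I n] by auto

text \<open>Compatibility of a sequence is containment of cosets. Sums of sets are monotone; a
  product of cosets is a union of translates of the ideal power, so there the inclusion of each
  power in the preceding one enters as well. Closure is what later permits cancelling an isomorphism
  that is injective only on the carrier.\<close>

lemma (in ring) completion_closed:
  assumes I: "ideal I R" and s: "s \<in> carrier (completion R I)" and t: "t \<in> carrier (completion R I)"
  shows "s \<oplus>\<^bsub>completion R I\<^esub> t \<in> carrier (completion R I)"
    and "s \<otimes>\<^bsub>completion R I\<^esub> t \<in> carrier (completion R I)"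
proof -
  have Q: "ring (R Quot ideal_power R I n)" for n
    by (rule ideal.quotient_is_ring[OF ideal_ideal_power[OF I]])
  have st: "s n \<in> carrier (R Quot ideal_power R I n)" "t n \<in> carrier (R Quot ideal_power R I n)"
    "s (Suc n) \<subseteq> s n" "t (Suc n) \<subseteq> t n" for n
    using s t by (auto simp: completion_def)
  have "s (Suc n) \<oplus>\<^bsub>R Quot ideal_power R I (Suc n)\<^esub> t (Suc n) \<subseteq> s n \<oplus>\<^bsub>R Quot ideal_power R I n\<^esub> t n" for n
    using st(3,4)[of n] by (auto simp: FactRing_def set_add_def')
  moreover have "s (Suc n) \<otimes>\<^bsub>R Quot ideal_power R I (Suc n)\<^esub> t (Suc n) \<subseteq> s n \<otimes>\<^bsub>R Quot ideal_power R I n\<^esub> t n" for n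
    using st(3,4)[of n] ideal_power_Suc_subset[OF I, of n]
    by (simp add: FactRing_def rcoset_mult_def a_r_coset_def' del: ideal_power.simps) blast
  ultimately show "s \<oplus>\<^bsub>completion R I\<^esub> t \<in> carrier (completion R I)"
    "s \<otimes>\<^bsub>completion R I\<^esub> t \<in> carrier (completion R I)"
    using st Q by (auto simp: completion_def ring.ring_simprules simp del: ideal_power.simps)
qed

lemma zero_in_ideal_power:
  assumes "eval3 g P = 0"
  shows "\<zero>\<^bsub>local_ring g P\<^esub> \<in> ideal_power (local_ring g P) (nonunits (local_ring g P)) n"
  using ring.ideal_ideal_power[OF cring.axioms(1)[OF cring_local_ring] ideal_nonunits_local_ring[OF assms]]
  by (simp add: additive_subgroup.zero_closed ideal.axioms(1))

text \<open>Representatives modulo the third power of the maximal ideal suffice to see quadratic parts.\<close>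

definition lifts :: "poly3 \<Rightarrow> complex^3 \<Rightarrow> (nat \<Rightarrow> poly3 fract set set) \<Rightarrow> poly3 fract \<Rightarrow> bool" where
  "lifts g P s r \<longleftrightarrow> r \<in> carrier (local_ring3 P) \<and> local_ring_class g P r \<in> s 3"

lemma carrier_complete_local_ring:
  "s \<in> carrier (complete_local_ring g P) \<longleftrightarrow> (\<forall>n. s (Suc n) \<subseteq> s n \<and> (\<exists>a\<in>carrier (local_ring g P).
     s n = {m \<oplus>\<^bsub>local_ring g P\<^esub> a | m. m \<in> ideal_power (local_ring g P) (nonunits (local_ring g P)) n}))"
proof -
  have *: "(\<Union>h\<in>N. {f h}) = {f h | h. h \<in> N}" for N :: "'a set" and f :: "'a \<Rightarrow> 'b"
    by blast
  show ?thesis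
    unfolding complete_local_ring_def completion_def
    by (simp add: FactRing_def A_RCOSETS_def' a_r_coset_def' *) blast
qed

lemma lifts_exists:
  assumes "s \<in> carrier (complete_local_ring g P)" "eval3 g P = 0"
  obtains r where "lifts g P s r"
proof -
  interpret R: cring "local_ring g P" by (rule cring_local_ring)
  obtain a where a: "a \<in> carrier (local_ring g P)"
     "s 3 = {m \<oplus>\<^bsub>local_ring g P\<^esub> a | m. m \<in> ideal_power (local_ring g P) (nonunits (local_ring g P)) 3}"
    using assms(1) unfolding carrier_complete_local_ring by blast
  obtain r where r: "r \<in> carrier (local_ring3 P)" "a = local_ring_class g P r"
    using a(1) by (auto simp: carrier_local_ring)
  have "a \<in> s 3"
    unfolding a(2) using zero_in_ideal_power[OF assms(2)] a(1) R.l_zero by fastforce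
  thus ?thesis using that r by (auto simp: lifts_def)
qed

text \<open>The component \<open>s 3\<close> is a single coset of the cube of the maximal ideal, so
  both representatives differ from a fixed one by an element of that cube and a multiple of
  \<open>g\<close>.\<close>

lemma lifts_unique:
  assumes "s \<in> carrier (complete_local_ring g P)" "lifts g P s r" "lifts g P s r'"
  shows "vanishes_mod g P 3 (r - r')"
proof -
  obtain a where a: "a \<in> carrier (local_ring g P)"
     "s 3 = {m \<oplus>\<^bsub>local_ring g P\<^esub> a | m. m \<in> ideal_power (local_ring g P) (nonunits (local_ring g P)) 3}"
    using assms(1) unfolding carrier_complete_local_ring by blast
  obtain r0 where r0: "r0 \<in> carrier (local_ring3 P)" "a = local_ring_class g P r0"
    using a(1) by (auto simp: carrier_local_ring)
  have *: "vanishes_mod g P 3 (t - r0)" if t: "lifts g P s t" for t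
  proof -
    obtain m where m: "m \<in> ideal_power (local_ring g P) (nonunits (local_ring g P)) 3"
      "local_ring_class g P t = m \<oplus>\<^bsub>local_ring g P\<^esub> a"
      using t a by (auto simp: lifts_def)
    obtain \<mu> where \<mu>: "\<mu> \<in> carrier (local_ring3 P)" "m = local_ring_class g P \<mu>" "vanishes_mod g P 3 \<mu>"
      using ideal_power_nonunits[OF m(1)] by blast
    have "local_ring_class g P t = local_ring_class g P (\<mu> + r0)"
      using m \<mu> r0 by (simp add: local_ring_class_simps)
    then obtain x where "x \<in> carrier (local_ring3 P)" "t = x * Fract g 1 + (\<mu> + r0)"
      by (rule local_ring_class_eqD) (use t \<mu> r0 in \<open>simp_all add: lifts_def local_ring3_closed\<close>)
    thus ?thesis using vanishes_mod_add_ideal[OF \<mu>(3)] by (simp add: add.assoc[symmetric])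
  qed
  show ?thesis
    using vanishes_mod_add[OF *[OF assms(2)] vanishes_mod_minus[OF *[OF assms(3)]]] by simp
qed

lemma lifts_add:
  assumes "lifts g P s r" "lifts g P t r'"
  shows "lifts g P (s \<oplus>\<^bsub>complete_local_ring g P\<^esub> t) (r + r')"
  using assms local_ring_class_simps(1)[of r P r' g, symmetric]
  by (auto simp: lifts_def complete_local_ring_def completion_def FactRing_def set_add_def'
      local_ring3_closed)

lemma lifts_mult:
  assumes "lifts g P s r" "lifts g P t r'" "eval3 g P = 0"
  shows "lifts g P (s \<otimes>\<^bsub>complete_local_ring g P\<^esub> t) (r * r')"
proof -
  interpret R: cring "local_ring g P" by (rule cring_local_ring)
  have c: "r \<in> carrier (local_ring3 P)" "r' \<in> carrier (local_ring3 P)"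
    using assms by (auto simp: lifts_def)
  \<comment> \<open>The product of two cosets is a union of translates of the ideal power, so the
    product of the representatives is found in it as zero plus itself.\<close>
  have "local_ring_class g P (r * r') = \<zero>\<^bsub>local_ring g P\<^esub> \<oplus>\<^bsub>local_ring g P\<^esub>
     (local_ring_class g P r \<otimes>\<^bsub>local_ring g P\<^esub> local_ring_class g P r')"
    using c by (simp add: local_ring_class_simps local_ring_class_closed local_ring3_closed)
  thus ?thesis
    using assms c zero_in_ideal_power[OF assms(3), of 3]
    by (auto simp: lifts_def complete_local_ring_def completion_def FactRing_def rcoset_mult_def
      local_ring3_closed a_r_coset_def')
qed

lemma completion_map_in_carrier:
  assumes "a \<in> carrier (local_ring g P)" "eval3 g P = 0"
  shows "completion_map (local_ring g P) (nonunits (local_ring g P)) a \<in> carrier (complete_local_ring g P)"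
proof -
  interpret R: cring "local_ring g P" by (rule cring_local_ring)
  from R.ideal_power_Suc_subset[OF ideal_nonunits_local_ring[OF assms(2)]] assms(1) show ?thesis
    unfolding carrier_complete_local_ring completion_map_def a_r_coset_def' by blast
qed

lemma lifts_completion_map:
  assumes "r \<in> carrier (local_ring3 P)" "eval3 g P = 0"
  shows "lifts g P (completion_map (local_ring g P) (nonunits (local_ring g P)) (local_ring_class g P r)) r"
proof -
  interpret R: cring "local_ring g P" by (rule cring_local_ring)
  have "local_ring_class g P r = \<zero>\<^bsub>local_ring g P\<^esub> \<oplus>\<^bsub>local_ring g P\<^esub> local_ring_class g P r"
    using assms by (simp add: local_ring_class_closed)
  thus ?thesis
    using assms zero_in_ideal_power[OF assms(2), of 3]
    by (auto simp: lifts_def completion_map_def a_r_coset_def')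
qed

section \<open>The quadratic part at an \<open>A\<^sub>1\<close>-point\<close>

lemma fps3_ring_simps [simp]: "carrier fps3_ring = UNIV" "mult fps3_ring = (*)" "add fps3_ring = (+)"
    "one fps3_ring = 1" "zero fps3_ring = 0"
  by (simp_all add: fps3_ring_def)

lemma cring_fps3_ring: "cring fps3_ring"
proof (intro cringI abelian_groupI comm_monoidI)
  fix x :: fps3
  show "\<exists>y\<in>carrier fps3_ring. y \<oplus>\<^bsub>fps3_ring\<^esub> x = \<zero>\<^bsub>fps3_ring\<^esub>"
    by (intro bexI[of _ "- x"]) simp_all
qed (simp_all add: algebra_simps)

lemma ideal_A_ideal: "ideal (A_ideal n) fps3_ring"
  unfolding A_ideal_def by (rule cring.cgenideal_ideal[OF cring_fps3_ring]) simp

abbreviation A_class :: "nat \<Rightarrow> fps3 \<Rightarrow> fps3 set" where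
  "A_class n p \<equiv> A_ideal n +>\<^bsub>fps3_ring\<^esub> p"

lemma A_class_simps:
  "A_class n p \<oplus>\<^bsub>A_ring n\<^esub> A_class n q = A_class n (p + q)"
  "A_class n p \<otimes>\<^bsub>A_ring n\<^esub> A_class n q = A_class n (p * q)"
  "A_class n p \<in> carrier (A_ring n)"
proof -
  have "A_class n \<in> ring_hom fps3_ring (A_ring n)"
    unfolding A_ring_def by (rule ideal.rcos_ring_hom[OF ideal_A_ideal])
  from ring_hom_add[OF this, of p q] ring_hom_mult[OF this, of p q] ring_hom_closed[OF this, of p]
  show "A_class n p \<oplus>\<^bsub>A_ring n\<^esub> A_class n q = A_class n (p + q)"
    "A_class n p \<otimes>\<^bsub>A_ring n\<^esub> A_class n q = A_class n (p * q)"
    "A_class n p \<in> carrier (A_ring n)" by simp_all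
qed

lemma A_ring_carrierE:
  assumes "a \<in> carrier (A_ring n)"
  obtains p where "a = A_class n p"
  using assms by (auto simp: A_ring_def FactRing_def A_RCOSETS_def')

lemma A_class_generator:
  "A_class n (fps_const (fps_const fps_X) ^ 2 + fps_const fps_X ^ 2 + fps_X ^ (n + 1)) = A_class n 0"
  (is "A_class n ?p = _")
proof -
  interpret cring fps3_ring by (rule cring_fps3_ring)
  have "?p \<in> A_ideal n"
    unfolding A_ideal_def by (rule cgenideal_self) simp
  moreover have "subgroup (A_ideal n) (add_monoid fps3_ring)"
    using ideal_A_ideal[of n] by (simp add: ideal_def additive_subgroup_def)
  ultimately have "A_class n x = A_ideal n" if "x \<in> A_ideal n" for x
    using that add.coset_join2[of x "A_ideal n"] by (simp add: a_r_coset_def)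
  moreover have "0 \<in> A_ideal n"
    using additive_subgroup.zero_closed[OF ideal.axioms(1)[OF ideal_A_ideal]] by simp
  ultimately show ?thesis using \<open>?p \<in> A_ideal n\<close> by simp
qed

text \<open>A negated geometric series. It is stated over a commutative ring with an explicit
  inverse \<open>c'\<close> because the coefficients are themselves power series in two of the three
  layers.\<close>

lemma fps_X_minus_const_inverse:
  fixes c c' :: "'a :: comm_ring_1"
  assumes "c * c' = 1"
  shows "(fps_X - fps_const c) * Abs_fps (\<lambda>n. - (c' ^ (n + 1))) = 1"
proof (rule fps_ext)
  fix n
  show "fps_nth ((fps_X - fps_const c) * Abs_fps (\<lambda>n. - (c' ^ (n + 1)))) n = fps_nth 1 n"
  proof (cases n)
    case (Suc m)
    have "c * (c' * c' ^ Suc m) = (c * c') * c' ^ Suc m" by (simp only: mult.assoc)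
    thus ?thesis using assms Suc by (simp add: left_diff_distrib)
  qed (use assms in \<open>simp add: left_diff_distrib\<close>)
qed

lemma fps_split: "p = fps_const (fps_nth p 0) + fps_X * fps_shift 1 (p :: 'a :: comm_ring_1 fps)"
  by (rule fps_ext) (simp add: fps_X_mult_nth)

definition fps3_const :: "complex \<Rightarrow> fps3" where
  "fps3_const c = fps_const (fps_const (fps_const c))"

definition fps3_vars :: "3 \<Rightarrow> fps3" where
  "fps3_vars i = (if i = 1 then fps_const (fps_const fps_X) else if i = 2 then fps_const fps_X else fps_X)"

text \<open>Constant terms are split off from the outermost layer inward. Through the isomorphism
  this makes every element of the completed local ring a constant plus a combination of three fixed
  elements.\<close>

lemma fps3_split:
  obtains c q where "p = fps3_const c + (\<Sum>i\<in>UNIV. fps3_vars i * q i)"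
proof -
  define a where "a = fps_nth p 0"
  define b where "b = fps_nth a 0"
  define q where "q i = (if i = 1 then fps_const (fps_const (fps_shift 1 b)) else
     if i = 2 then fps_const (fps_shift 1 a) else fps_shift 1 p)" for i :: 3
  have b: "b = fps_const (fps_nth b 0) + fps_X * fps_shift 1 b" by (rule fps_split)
  have a: "a = fps_const b + fps_X * fps_shift 1 a" unfolding b_def by (rule fps_split)
  have p: "p = fps_const a + fps_X * fps_shift 1 p" unfolding a_def by (rule fps_split)
  have "fps_const (fps_const b) = fps3_const (fps_nth b 0) + fps3_vars 1 * q 1"
    by (subst b) (simp add: fps3_const_def fps3_vars_def q_def flip: fps_const_add fps_const_mult)
  moreover have "fps_const a = fps_const (fps_const b) + fps3_vars 2 * q 2"
    by (subst a) (simp add: fps3_vars_def q_def flip: fps_const_add fps_const_mult)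
  moreover have "p = fps_const a + fps3_vars 3 * q 3"
    using p by (simp add: fps3_vars_def q_def)
  ultimately have "p = fps3_const (fps_nth b 0) + (\<Sum>i\<in>UNIV. fps3_vars i * q i)"
    by (simp add: sum_3 add.assoc)
  thus ?thesis by (rule that)
qed

text \<open>Serves to show that the variables correspond to germs vanishing at \<open>P\<close>: a
  variable minus a nonzero constant is invertible, whereas a germ minus its own value at
  \<open>P\<close> is not.\<close>

lemma fps3_vars_minus_const_unit:
  assumes "c \<noteq> 0"
  obtains w where "(fps3_vars i + fps3_const (- c)) * w = 1"
proof -
  have c: "c * inverse c = 1" using assms by simp
  have "\<exists>w. (fps3_vars i + fps3_const (- c)) * w = 1"
  proof -
    consider "i = 1" | "i = 2" | "i = 3" using exhaust_3 by blast
    thus ?thesis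
    proof cases
      case 1
      have "(fps3_vars i + fps3_const (- c)) * fps_const (fps_const (Abs_fps (\<lambda>n. - (inverse c ^ (n + 1))))) =
        fps_const (fps_const ((fps_X - fps_const c) * Abs_fps (\<lambda>n. - (inverse c ^ (n + 1)))))"
        using 1 by (simp add: fps3_vars_def fps3_const_def flip: fps_const_add fps_const_mult fps_const_sub fps_const_neg)
      thus ?thesis using fps_X_minus_const_inverse[OF c] by auto
    next
      case 2
      have c': "fps_const c * fps_const (inverse c) = 1" using c by simp
      have "(fps3_vars i + fps3_const (- c)) * fps_const (Abs_fps (\<lambda>n. - (fps_const (inverse c) ^ (n + 1)))) =
        fps_const ((fps_X - fps_const (fps_const c)) * Abs_fps (\<lambda>n. - (fps_const (inverse c) ^ (n + 1))))"
        using 2 by (simp add: fps3_vars_def fps3_const_def flip: fps_const_add fps_const_mult fps_const_sub fps_const_neg)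
      thus ?thesis using fps_X_minus_const_inverse[OF c'] by auto
    next
      case 3
      have c': "fps_const (fps_const c) * fps_const (fps_const (inverse c)) = 1" using c by simp
      have "fps3_vars i + fps3_const (- c) = fps_X - fps_const (fps_const (fps_const c))"
        using 3 by (simp add: fps3_vars_def fps3_const_def flip: fps_const_neg)
      thus ?thesis using fps_X_minus_const_inverse[OF c'] by auto
    qed
  qed
  thus ?thesis using that by blast
qed

lemma complete_local_ring_const_eq:
  "complete_local_ring_const g P c = completion_map (local_ring g P) (nonunits (local_ring g P))
     (local_ring_class g P (Fract (const3 c) 1))"
  by (simp add: complete_local_ring_const_def local_ring_const_def)

text \<open>The assumption on \<open>D\<^sub>0\<close> puts it in the radical of the quadratic part
  of \<open>g\<close>: translation by it changes no value. In the coordinates given by the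
  first-order parts of the three variables, a multiple of this quadratic part is a sum of three
  squares, and that form has radical zero.\<close>

lemma A1_kernel_trivial:
  fixes P D\<^sub>0 :: "complex^3"
  assumes A1: "A_type_singularity 1 g P" and sing: "singular_point g P"
    and ker: "\<And>D. coeff (line P (D + D\<^sub>0) g) 2 = coeff (line P D g) 2"
  shows "D\<^sub>0 = 0"
proof -
  let ?R = "local_ring g P" and ?C = "complete_local_ring g P" and ?A = "A_ring 1"
  let ?k = "complete_local_ring_const g P" and ?L = "carrier (local_ring3 P)"
  have gP: "eval3 g P = 0" using sing by (simp add: singular_point_def)
  have g01: "fps_nth (jet P D (Fract g 1)) 0 = 0" "fps_nth (jet P D (Fract g 1)) 1 = 0"
     "fps_nth (jet P D (Fract g 1)) 2 = coeff (line P D g) 2" for D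
    using sing coeff_line_1[of P D g] by (simp_all add: singular_point_def jet_Fract_1)
  obtain h where h: "h \<in> ring_iso ?C ?A" and hk: "\<And>c. h (?k c) = A_ring_const 1 c"
    using A1 by (auto simp: A_type_singularity_def)
  have hom: "h \<in> ring_hom ?C ?A" and bij: "bij_betw h (carrier ?C) (carrier ?A)"
    using h by (auto simp: ring_iso_def)
  have inj: "s = t" if "h s = h t" "s \<in> carrier ?C" "t \<in> carrier ?C" for s t
    using bij that by (auto simp: bij_betw_def inj_on_def)
  have surj: "\<exists>s. s \<in> carrier ?C \<and> h s = A_class 1 p" for p
  proof -
    have "A_class 1 p \<in> h ` carrier ?C"
      using bij A_class_simps(3)[of 1 p] unfolding bij_betw_def by blast
    thus ?thesis by (auto simp: image_iff)
  qed
  \<comment> \<open>\<open>\<sigma> p\<close> is the element of the completion matching the class of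
    \<open>p\<close>, and \<open>\<tau> p\<close> is a germ representing it modulo the cube of the
    maximal ideal. Injectivity of \<open>h\<close> makes \<open>\<sigma>\<close> compatible with
    sums, products and constants; \<open>\<tau>\<close> inherits this up to order three and modulo
    \<open>g\<close>.\<close>
  define \<sigma> where "\<sigma> p = (SOME s. s \<in> carrier ?C \<and> h s = A_class 1 p)" for p
  have \<sigma>: "\<sigma> p \<in> carrier ?C" "h (\<sigma> p) = A_class 1 p" for p
    using someI_ex[OF surj[of p]] by (simp_all add: \<sigma>_def)
  define \<tau> where "\<tau> p = (SOME r. lifts g P (\<sigma> p) r)" for p
  have \<tau>: "lifts g P (\<sigma> p) (\<tau> p)" for p
    unfolding \<tau>_def using lifts_exists[OF \<sigma>(1) gP] by (metis someI)
  have \<tau>_carrier [simp]: "\<tau> p \<in> ?L" for p using \<tau> by (simp add: lifts_def)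
  have k: "?k c \<in> carrier ?C" "lifts g P (?k c) (Fract (const3 c) 1)" for c
    unfolding complete_local_ring_const_eq
    by (auto intro!: completion_map_in_carrier lifts_completion_map local_ring_class_closed gP)
  have \<sigma>_eqI: "\<sigma> p = s" if "s \<in> carrier ?C" "h s = A_class 1 p" for p s
    using \<sigma> that by (intro inj) simp_all
  have closed: "s \<oplus>\<^bsub>?C\<^esub> t \<in> carrier ?C \<and> s \<otimes>\<^bsub>?C\<^esub> t \<in> carrier ?C"
    if "s \<in> carrier ?C" "t \<in> carrier ?C" for s t
    using ring.completion_closed[OF cring.axioms(1)[OF cring_local_ring] ideal_nonunits_local_ring[OF gP]] that
    by (simp add: complete_local_ring_def)
  have \<sigma>_const: "\<sigma> (fps3_const c) = ?k c" for c
    using k by (intro \<sigma>_eqI) (simp_all add: hk A_ring_const_def fps3_const_def)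
  have \<sigma>_add: "\<sigma> (p + q) = \<sigma> p \<oplus>\<^bsub>?C\<^esub> \<sigma> q" and \<sigma>_mult: "\<sigma> (p * q) = \<sigma> p \<otimes>\<^bsub>?C\<^esub> \<sigma> q" for p q
    using closed \<sigma> by (intro \<sigma>_eqI; simp add: ring_hom_add[OF hom] ring_hom_mult[OF hom] A_class_simps)+
  have \<tau>_unique: "vanishes_mod g P 3 (r - r')" if "lifts g P (\<sigma> p) r" "lifts g P (\<sigma> p) r'" for p r r'
    using lifts_unique[OF \<sigma>(1)] that by blast
  \<comment> \<open>If the lift of a variable had value \<open>c\<close> different from 0, the
    variable minus \<open>c\<close> would be a unit while its lift vanishes at \<open>P\<close>;
    constant terms then give 0 = 1. Matching the two copies of \<open>c\<close> uses that
    \<open>h\<close> respects the complex constants.\<close>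
  have \<tau>_vars: "fps_nth (jet P D (\<tau> (fps3_vars i))) 0 = 0" for i D
  proof (rule ccontr)
    define c where "c = fps_nth (jet P 0 (\<tau> (fps3_vars i))) 0"
    assume "fps_nth (jet P D (\<tau> (fps3_vars i))) 0 \<noteq> 0"
    hence "c \<noteq> 0" using jet_0[OF \<tau>_carrier[of "fps3_vars i"], of D 0] by (simp add: c_def)
    then obtain w where w: "(fps3_vars i + fps3_const (- c)) * w = 1"
      by (rule fps3_vars_minus_const_unit)
    let ?r = "\<tau> (fps3_vars i) + Fract (const3 (- c)) 1"
    have r: "?r \<in> ?L" by (simp add: local_ring3_closed)
    have "lifts g P (\<sigma> 1) (?r * \<tau> w)"
      unfolding w[symmetric] \<sigma>_mult \<sigma>_add \<sigma>_const
      by (intro lifts_mult lifts_add \<tau> k gP)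
    moreover have "lifts g P (\<sigma> 1) (Fract (const3 1) 1)"
      using k(2)[of 1] \<sigma>_const[of 1] by (simp add: fps3_const_def)
    ultimately have "vanishes_mod g P 3 (?r * \<tau> w - Fract (const3 1) 1)" by (rule \<tau>_unique)
    then obtain x where x: "x \<in> ?L"
      "fps_nth (jet P 0 (?r * \<tau> w - Fract (const3 1) 1 - x * Fract g 1)) 0 = 0"
      by (auto simp: vanishes_mod_def)
    have "jet P 0 (?r * \<tau> w - Fract (const3 1) 1 - x * Fract g 1) =
        jet P 0 ?r * jet P 0 (\<tau> w) - 1 - jet P 0 x * jet P 0 (Fract g 1)"
      using r x(1) by (simp add: jet_diff jet_mult local_ring3_closed jet_const3)
    moreover have "fps_nth (jet P 0 ?r) 0 = 0"
      by (simp add: jet_add jet_const3 c_def)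
    ultimately show False using x(2) g01(1)[of 0] by simp
  qed
  have "\<exists>L :: complex^3. \<forall>D. fps_nth (jet P D (\<tau> (fps3_vars i))) 1 = L $ 1 * D $ 1 + L $ 2 * D $ 2 + L $ 3 * D $ 3" for i
    using jet_1_linear[OF \<tau>_carrier] by metis
  then obtain M :: "3 \<Rightarrow> complex^3" where M: "\<And>i D. fps_nth (jet P D (\<tau> (fps3_vars i))) 1 =
      M i $ 1 * D $ 1 + M i $ 2 * D $ 2 + M i $ 3 * D $ 3" by metis
  define A :: "complex^3^3" where "A = (\<chi> i j. M i $ j)"
  have A: "fps_nth (jet P D (\<tau> (fps3_vars i))) 1 = (A *v D) $ i" for i D
    by (simp only: M) (simp add: A_def matrix_vector_mult_def sum_3)
  \<comment> \<open>A direction killed by the three first-order parts kills the first-order part of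
    every germ, because the variables generate the maximal ideal and \<open>g\<close> contributes
    nothing in first order. The coordinate functions then force \<open>D = 0\<close>.\<close>
  have A_inj: "D = 0" if D: "A *v D = 0" for D
  proof -
    have coord: "coeff (line P D p) 1 = 0" for p
    proof -
      let ?s = "completion_map ?R (nonunits ?R) (local_ring_class g P (Fract p 1))"
      have s: "?s \<in> carrier ?C" "lifts g P ?s (Fract p 1)"
        by (auto intro!: completion_map_in_carrier lifts_completion_map local_ring_class_closed gP)
      have "h ?s \<in> carrier ?A" using ring_hom_closed[OF hom s(1)] .
      then obtain q where "h ?s = A_class 1 q" by (rule A_ring_carrierE)
      hence \<sigma>q: "\<sigma> q = ?s" using s by (intro \<sigma>_eqI)
      obtain c u where q: "q = fps3_const c + (\<Sum>i\<in>UNIV. fps3_vars i * u i)" by (rule fps3_split)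
      let ?r = "Fract (const3 c) 1 + (\<tau> (fps3_vars 1) * \<tau> (u 1) + \<tau> (fps3_vars 2) * \<tau> (u 2)
        + \<tau> (fps3_vars 3) * \<tau> (u 3))"
      have "lifts g P (\<sigma> q) ?r"
        unfolding q sum_3 \<sigma>_mult \<sigma>_add \<sigma>_const
        by (intro lifts_mult lifts_add \<tau> k gP)
      with s(2) have "vanishes_mod g P 3 (Fract p 1 - ?r)"
        unfolding \<sigma>q[symmetric] by (rule \<tau>_unique)
      then obtain x where x: "x \<in> ?L" "fps_nth (jet P D (Fract p 1 - ?r - x * Fract g 1)) 1 = 0"
        by (auto simp: vanishes_mod_def)
      have "jet P D (Fract p 1 - ?r - x * Fract g 1) = fps_of_poly (line P D p) - (fps_const c +
          (jet P D (\<tau> (fps3_vars 1)) * jet P D (\<tau> (u 1)) + jet P D (\<tau> (fps3_vars 2)) * jet P D (\<tau> (u 2))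
          + jet P D (\<tau> (fps3_vars 3)) * jet P D (\<tau> (u 3)))) - jet P D x * jet P D (Fract g 1)"
        using x(1) by (simp add: jet_diff jet_add jet_mult local_ring3_closed line_const3 jet_Fract_1 fps_of_poly_const)
      from arg_cong[OF this, of "\<lambda>f. fps_nth f 1"] x(2) show ?thesis
        using g01[of D] \<tau>_vars[of D] A[of D] D by (simp add: fps_mult_nth_1)
    qed
    have coords: "line P D [:[:[:0, 1:]:]:] = [:P $ 1, D $ 1:]" "line P D [:[:0, 1:]:] = [:P $ 2, D $ 2:]"
      "line P D [:0, 1:] = [:P $ 3, D $ 3:]"
      by (rule line_eqI, simp add: eval3_simps)+
    from coord[of "[:[:[:0, 1:]:]:]"] coord[of "[:[:0, 1:]:]"] coord[of "[:0, 1:]"]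
    show "D = 0" unfolding coords by (simp add: vec_eq_iff forall_3)
  qed
  \<comment> \<open>Real linearity suffices: on a finite-dimensional real space injectivity already
    yields surjectivity.\<close>
  have lin: "linear ((*v) A)" 
    by (rule linearI) (simp_all add: vec_eq_iff matrix_vector_mult_def scaleR_sum_right distrib_left sum.distrib)
  have "inj ((*v) A)" using A_inj lin by (simp add: linear_injective_0)
  hence surj: "surj ((*v) A)" using lin linear_injective_imp_surjective by blast
  \<comment> \<open>Compare coefficients of \<open>t^2\<close> in the lifted relation. The lifts
    have value zero, so only squares of first-order parts remain; in the multiple of
    \<open>g\<close> only the value of the cofactor at \<open>P\<close> meets the quadratic part,
    and this value is the constant \<open>c\<close>.\<close>
  obtain c where c: "\<And>D. (\<Sum>i\<in>UNIV. ((A *v D) $ i)\<^sup>2) = c * coeff (line P D g) 2"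
  proof -
    have "lifts g P (\<sigma> (fps3_vars 1 * fps3_vars 1 + fps3_vars 2 * fps3_vars 2 + fps3_vars 3 * fps3_vars 3))
      (\<tau> (fps3_vars 1) * \<tau> (fps3_vars 1) + \<tau> (fps3_vars 2) * \<tau> (fps3_vars 2) + \<tau> (fps3_vars 3) * \<tau> (fps3_vars 3))"
      (is "lifts g P (\<sigma> ?q) ?r")
      unfolding \<sigma>_mult \<sigma>_add by (intro lifts_mult lifts_add \<tau> gP)
    moreover have "A_class 1 ?q = A_class 1 0"
      using A_class_generator[of 1] by (simp add: fps3_vars_def power2_eq_square)
    hence "\<sigma> ?q = \<sigma> 0" using \<sigma> by (intro \<sigma>_eqI) simp_all
    hence "lifts g P (\<sigma> ?q) (Fract (const3 0) 1)"
      using k(2)[of 0] \<sigma>_const[of 0] by (simp add: fps3_const_def)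
    ultimately have "vanishes_mod g P 3 (?r - Fract (const3 0) 1)" by (rule \<tau>_unique)
    then obtain x where x: "x \<in> ?L"
      "\<And>D. fps_nth (jet P D (?r - Fract (const3 0) 1 - x * Fract g 1)) 2 = 0"
      by (auto simp: vanishes_mod_def)
    have "(\<Sum>i\<in>UNIV. ((A *v D) $ i)\<^sup>2) = fps_nth (jet P 0 x) 0 * coeff (line P D g) 2" for D
    proof -
      have sq: "fps_nth (f * f') 2 = fps_nth f 0 * fps_nth f' 2 + fps_nth f 1 * fps_nth f' 1
          + fps_nth f 2 * fps_nth f' 0" for f f' :: "complex fps"
        by (simp add: fps_mult_nth numeral_2_eq_2)
      have "jet P D (?r - Fract (const3 0) 1 - x * Fract g 1) = jet P D (\<tau> (fps3_vars 1)) * jet P D (\<tau> (fps3_vars 1))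
        + jet P D (\<tau> (fps3_vars 2)) * jet P D (\<tau> (fps3_vars 2)) + jet P D (\<tau> (fps3_vars 3)) * jet P D (\<tau> (fps3_vars 3))
        - jet P D x * jet P D (Fract g 1)"
        using x(1) by (simp add: jet_diff jet_add jet_mult local_ring3_closed jet_const3)
      from arg_cong[OF this, of "\<lambda>f. fps_nth f 2"] x(2)[of D]
      have "(A *v D) $ 1 * (A *v D) $ 1 + (A *v D) $ 2 * (A *v D) $ 2 + (A *v D) $ 3 * (A *v D) $ 3
        = fps_nth (jet P D x) 0 * coeff (line P D g) 2"
        by (simp only: fps_add_nth fps_sub_nth sq g01 \<tau>_vars A) simp
      thus ?thesis using jet_0[OF x(1), of D 0] by (simp add: sum_3 power2_eq_square)
    qed
    thus ?thesis by (rule that)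
  qed
  define e where "e = A *v D\<^sub>0"
  have key: "(\<Sum>i\<in>UNIV. (v $ i + e $ i)\<^sup>2) = (\<Sum>i\<in>UNIV. (v $ i)\<^sup>2)" for v :: "complex^3"
  proof -
    obtain D where "v = A *v D" using surj by (metis surjD)
    thus ?thesis using c[of "D + D\<^sub>0"] c[of D] ker[of D] by (simp add: matrix_vector_right_distrib e_def)
  qed
  \<comment> \<open>Over the complex numbers a vanishing sum of squares does not make
    \<open>e\<close> zero. It only removes the quadratic term when \<open>key\<close> is expanded at
    a unit vector, which leaves \<open>2 * e $ i = 0\<close>.\<close>
  have "e $ i = 0" for i
  proof -
    have 0: "(\<Sum>i\<in>UNIV. (e $ i)\<^sup>2) = 0" using key[of 0] by simp
    have "(\<Sum>j\<in>UNIV. (axis i 1 $ j + e $ j)\<^sup>2) = (\<Sum>j\<in>UNIV. (axis i 1 $ j :: complex)\<^sup>2)" by (rule key)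
    moreover have "(\<Sum>j\<in>UNIV. (axis i 1 $ j + e $ j)\<^sup>2) = (\<Sum>j\<in>UNIV. (axis i 1 $ j :: complex)\<^sup>2)
       + 2 * (\<Sum>j\<in>UNIV. axis i 1 $ j * e $ j) + (\<Sum>j\<in>UNIV. (e $ j)\<^sup>2)"
      by (simp add: power2_sum sum.distrib sum_distrib_left algebra_simps)
    moreover have "(\<Sum>j\<in>UNIV. axis i 1 $ j * e $ j) = e $ i"
      by (simp add: axis_def if_distrib[of "\<lambda>x. x * _"] cong: if_cong)
    ultimately show "e $ i = 0" using 0 by simp
  qed
  hence "A *v D\<^sub>0 = 0" by (simp add: vec_eq_iff e_def)
  thus ?thesis by (rule A_inj)
qed

section \<open>Polar forms\<close>

text \<open>Working with the polarization of a form makes the conditions for singularity and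
  degeneracy multilinear identities, free of derivatives and charts.\<close>

locale polar22 =
  fixes F :: "complex^2 \<Rightarrow> complex^2 \<Rightarrow> complex^3 \<Rightarrow> complex^3 \<Rightarrow> complex"
  assumes sym_x: "F x x' y y' = F x' x y y'" and sym_y: "F x x' y y' = F x x' y' y"
    and add_x1: "F (x + z) x' y y' = F x x' y y' + F z x' y y'"
    and scale_x1: "F (a *s x) x' y y' = a * F x x' y y'"
    and add_y1: "F x x' (y + w) y' = F x x' y y' + F x x' w y'"
    and scale_y1: "F x x' (a *s y) y' = a * F x x' y y'"
begin

lemma linear:
  "F (x + z) x' y y' = F x x' y y' + F z x' y y'" "F x (x' + z) y y' = F x x' y y' + F x z y y'"
  "F x x' (y + w) y' = F x x' y y' + F x x' w y'" "F x x' y (y' + w) = F x x' y y' + F x x' y w"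
  "F (a *s x) x' y y' = a * F x x' y y'" "F x (a *s x') y y' = a * F x x' y y'"
  "F x x' (a *s y) y' = a * F x x' y y'" "F x x' y (a *s y') = a * F x x' y y'"
  using sym_x sym_y add_x1 add_y1 scale_x1 scale_y1 by metis+

lemma zero [simp]: "F 0 x' y y' = 0" "F x 0 y y' = 0" "F x x' 0 y' = 0" "F x x' y 0 = 0"
  using linear(5)[of 0 0] linear(6)[of _ 0 0] linear(7)[of _ _ 0 0] linear(8)[of _ _ _ 0 0] by simp_all

lemma minus: "F (- x) x' y y' = - F x x' y y'" "F x (- x') y y' = - F x x' y y'"
  "F x x' (- y) y' = - F x x' y y'" "F x x' y (- y') = - F x x' y y'"
  using linear(5)[of "-1" x] linear(6)[of _ "-1" x'] linear(7)[of _ _ "-1" y] linear(8)[of _ _ _ "-1" y']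
  by (simp_all add: vector_sneg_minus1[symmetric])

lemma diff: "F (x - z) x' y y' = F x x' y y' - F z x' y y'" "F x (x' - z) y y' = F x x' y y' - F x z y y'"
  "F x x' (y - w) y' = F x x' y y' - F x x' w y'" "F x x' y (y' - w) = F x x' y y' - F x x' y w"
  using linear(1)[of x "- z"] linear(2)[of _ x' "- z"] linear(3)[of _ _ y "- w"] linear(4)[of _ _ _ y' "- w"]
  by (simp_all add: minus)

text \<open>A singular point of the cone over the surface whose tangent cone is degenerate in a direction
  \<open>(\<xi>, \<eta>)\<close> transversal to the two scalings.\<close>

definition degenerate_at :: "complex^2 \<Rightarrow> complex^3 \<Rightarrow> complex^2 \<Rightarrow> complex^3 \<Rightarrow> bool" where
  "degenerate_at x y \<xi> \<eta> \<longleftrightarrow> x \<noteq> 0 \<and> y \<noteq> 0 \<and>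
     (\<forall>z. F x z y y = 0) \<and> (\<forall>w. F x x y w = 0) \<and>
     (\<forall>z. F z \<xi> y y + 2 * F x z y \<eta> = 0) \<and> (\<forall>w. 2 * F x \<xi> y w + F x x w \<eta> = 0) \<and>
     \<not> (\<exists>s t. \<xi> = s *s x \<and> \<eta> = t *s y)"

text \<open>The identity \<open>4 * B u v = Q (u + v) - Q (u - v)\<close> applied once in each group
  of variables. It converts bounds on values of a form into bounds on its coefficients.\<close>

lemma polarization:
  "16 * F x x' y y' = F (x + x') (x + x') (y + y') (y + y') - F (x - x') (x - x') (y + y') (y + y')
     - F (x + x') (x + x') (y - y') (y - y') + F (x - x') (x - x') (y - y') (y - y')"
  using sym_x sym_y by (simp add: linear diff algebra_simps)

end

text \<open>Averaging the coefficients over the swaps of the x-indices and of the y-indices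
  symmetrizes them without changing values on the diagonal. The coefficients are returned too, since
  they exhibit the continuity needed in the later limit.\<close>

lemma forms22_polar:
  assumes "f \<in> forms22"
  obtains F c where "polar22 F" "\<And>x y. f x y = F x x y y"
    "\<And>x x' y y'. F x x' y y' =
       (\<Sum>i\<in>UNIV. \<Sum>j\<in>UNIV. \<Sum>k\<in>UNIV. \<Sum>l\<in>UNIV. c i j k l * (x $ i * x' $ j) * (y $ k * y' $ l))"
proof -
  obtain c :: "2 \<Rightarrow> 2 \<Rightarrow> 3 \<Rightarrow> 3 \<Rightarrow> complex" where c: "\<And>x y. f x y =
     (\<Sum>i\<in>UNIV. \<Sum>j\<in>UNIV. \<Sum>k\<in>UNIV. \<Sum>l\<in>UNIV. c i j k l * (x $ i * x $ j) * (y $ k * y $ l))"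
    using assms by (auto simp: forms22_def)
  define G where "G c x x' y y' =
     (\<Sum>i\<in>UNIV. \<Sum>j\<in>UNIV. \<Sum>k\<in>UNIV. \<Sum>l\<in>UNIV. c i j k l * (x $ i * x' $ j) * (y $ k * y' $ l))"
    for c :: "2 \<Rightarrow> 2 \<Rightarrow> 3 \<Rightarrow> 3 \<Rightarrow> complex" and x x' :: "complex^2" and y y' :: "complex^3"
  define d where "d i j k l = (c i j k l + c j i k l + c i j l k + c j i l k) / 4" for i j k l
  have swap_x: "G (\<lambda>i j k l. c j i k l) x x' y y' = G c x' x y y'" for c x x' y y'
    unfolding G_def by (subst sum.swap) (simp add: ac_simps)
  have swap_y: "G (\<lambda>i j k l. c i j l k) x x' y y' = G c x x' y' y" for c x x' y y'
    unfolding G_def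
    by (rule sum.cong[OF refl], rule sum.cong[OF refl], subst sum.swap) (simp add: ac_simps)
  have Gd: "G d x x' y y' = (G c x x' y y' + G c x' x y y' + G c x x' y' y + G c x' x y' y) / 4" for x x' y y'
  proof -
    have "G d x x' y y' = (G c x x' y y' + G (\<lambda>i j k l. c j i k l) x x' y y' + G (\<lambda>i j k l. c i j l k) x x' y y'
        + G (\<lambda>i j k l. c j i l k) x x' y y') / 4"
      by (simp add: G_def d_def add_divide_distrib distrib_right sum.distrib sum_divide_distrib)
    also have "G (\<lambda>i j k l. c j i l k) x x' y y' = G (\<lambda>i j k l. c i j l k) x' x y y'"
      using swap_x[of "\<lambda>i j k l. c i j l k"] .
    finally show ?thesis by (simp only: swap_x[of c] swap_y[of c])
  qed
  have "polar22 (G d)"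
  proof
    fix x x' z :: "complex^2" and y y' w :: "complex^3" and a :: complex
    show "G d x x' y y' = G d x' x y y'" "G d x x' y y' = G d x x' y' y" by (simp_all add: Gd)
    show "G d (x + z) x' y y' = G d x x' y y' + G d z x' y y'" "G d x x' (y + w) y' = G d x x' y y' + G d x x' w y'"
      unfolding G_def by (simp_all add: sum.distrib algebra_simps)
    show "G d (a *s x) x' y y' = a * G d x x' y y'" "G d x x' (a *s y) y' = a * G d x x' y y'"
      unfolding G_def by (simp_all add: sum_distrib_left ac_simps)
  qed
  moreover have "f x y = G d x x y y" for x y
  proof -
    have "f x y = G c x x y y" by (simp add: c G_def)
    thus ?thesis by (simp add: Gd)
  qed
  ultimately show ?thesis by (rule that[of _ d]) (simp add: G_def)
qed

section \<open>A degenerate singular point of a destabilized form\<close>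

text \<open>Pairing basis vectors with weights lets one assumption range over all coefficients. The
  ordering makes \<open>X\<^sub>1\<close> and \<open>Y\<^sub>2\<close> vectors of least weight, the
  natural place to look for a bad singularity.\<close>

locale destabilized = polar22 F for F +
  fixes X\<^sub>0 X\<^sub>1 :: "complex^2" and Y\<^sub>0 Y\<^sub>1 Y\<^sub>2 :: "complex^3" and a b\<^sub>0 b\<^sub>1 b\<^sub>2 :: real
  assumes span_x: "\<And>z. \<exists>s t. z = s *s X\<^sub>0 + t *s X\<^sub>1"
    and span_y: "\<And>w. \<exists>r s t. w = r *s Y\<^sub>0 + s *s Y\<^sub>1 + t *s Y\<^sub>2"
    and indep_x: "\<And>s t. s *s X\<^sub>0 + t *s X\<^sub>1 = 0 \<Longrightarrow> s = 0 \<and> t = 0"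
    and indep_y: "\<And>r s t. r *s Y\<^sub>0 + s *s Y\<^sub>1 + t *s Y\<^sub>2 = 0 \<Longrightarrow> r = 0 \<and> s = 0 \<and> t = 0"
    and a: "a \<ge> 0" and b: "b\<^sub>0 \<ge> b\<^sub>1" "b\<^sub>1 \<ge> b\<^sub>2" "b\<^sub>0 + b\<^sub>1 + b\<^sub>2 = 0"
    and vanish: "\<And>x x' y y' \<alpha> \<alpha>' \<beta> \<beta>'. \<lbrakk>(x, \<alpha>) \<in> {(X\<^sub>0, a), (X\<^sub>1, - a)}; (x', \<alpha>') \<in> {(X\<^sub>0, a), (X\<^sub>1, - a)};
        (y, \<beta>) \<in> {(Y\<^sub>0, b\<^sub>0), (Y\<^sub>1, b\<^sub>1), (Y\<^sub>2, b\<^sub>2)}; (y', \<beta>') \<in> {(Y\<^sub>0, b\<^sub>0), (Y\<^sub>1, b\<^sub>1), (Y\<^sub>2, b\<^sub>2)};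
        \<alpha> + \<alpha>' + \<beta> + \<beta>' \<le> 0\<rbrakk> \<Longrightarrow> F x x' y y' = 0"
begin

text \<open>Each premise says that the total weight is not positive, after using that the weights
  sum to zero. The cases without premise rest on \<open>b\<^sub>2 \<le> 0\<close> and
  \<open>b\<^sub>1 + b\<^sub>2 \<le> 0\<close>.\<close>

lemma coeff_eq_0:
  "2 * a + 2 * b\<^sub>1 \<le> 0 \<Longrightarrow> F X\<^sub>0 X\<^sub>0 Y\<^sub>1 Y\<^sub>1 = 0" "2 * a + b\<^sub>1 + b\<^sub>2 \<le> 0 \<Longrightarrow> F X\<^sub>0 X\<^sub>0 Y\<^sub>1 Y\<^sub>2 = 0"
  "2 * a + 2 * b\<^sub>2 \<le> 0 \<Longrightarrow> F X\<^sub>0 X\<^sub>0 Y\<^sub>2 Y\<^sub>2 = 0"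
  "b\<^sub>1 \<ge> 0 \<Longrightarrow> F X\<^sub>0 X\<^sub>1 Y\<^sub>0 Y\<^sub>2 = 0" "b\<^sub>1 \<le> 0 \<Longrightarrow> F X\<^sub>0 X\<^sub>1 Y\<^sub>1 Y\<^sub>1 = 0"
  "F X\<^sub>0 X\<^sub>1 Y\<^sub>1 Y\<^sub>2 = 0" "F X\<^sub>0 X\<^sub>1 Y\<^sub>2 Y\<^sub>2 = 0"
  "b\<^sub>0 + b\<^sub>1 \<le> 2 * a \<Longrightarrow> F X\<^sub>1 X\<^sub>1 Y\<^sub>0 Y\<^sub>1 = 0" "b\<^sub>0 + b\<^sub>2 \<le> 2 * a \<Longrightarrow> F X\<^sub>1 X\<^sub>1 Y\<^sub>0 Y\<^sub>2 = 0"
  "2 * b\<^sub>1 \<le> 2 * a \<Longrightarrow> F X\<^sub>1 X\<^sub>1 Y\<^sub>1 Y\<^sub>1 = 0" "F X\<^sub>1 X\<^sub>1 Y\<^sub>1 Y\<^sub>2 = 0" "F X\<^sub>1 X\<^sub>1 Y\<^sub>2 Y\<^sub>2 = 0"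
proof -
  have 1: "b\<^sub>2 \<le> 0" "b\<^sub>1 + b\<^sub>2 \<le> 0" using b by linarith+
  note v = vanish[of X\<^sub>0 a X\<^sub>0 a] vanish[of X\<^sub>0 a X\<^sub>1 "- a"] vanish[of X\<^sub>1 "- a" X\<^sub>1 "- a"]
  show "2 * a + 2 * b\<^sub>1 \<le> 0 \<Longrightarrow> F X\<^sub>0 X\<^sub>0 Y\<^sub>1 Y\<^sub>1 = 0" using v(1)[of Y\<^sub>1 b\<^sub>1 Y\<^sub>1 b\<^sub>1] by simp
  show "2 * a + b\<^sub>1 + b\<^sub>2 \<le> 0 \<Longrightarrow> F X\<^sub>0 X\<^sub>0 Y\<^sub>1 Y\<^sub>2 = 0" using v(1)[of Y\<^sub>1 b\<^sub>1 Y\<^sub>2 b\<^sub>2] by simp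
  show "2 * a + 2 * b\<^sub>2 \<le> 0 \<Longrightarrow> F X\<^sub>0 X\<^sub>0 Y\<^sub>2 Y\<^sub>2 = 0" using v(1)[of Y\<^sub>2 b\<^sub>2 Y\<^sub>2 b\<^sub>2] by simp
  show "b\<^sub>1 \<ge> 0 \<Longrightarrow> F X\<^sub>0 X\<^sub>1 Y\<^sub>0 Y\<^sub>2 = 0" using v(2)[of Y\<^sub>0 b\<^sub>0 Y\<^sub>2 b\<^sub>2] b by simp
  show "b\<^sub>1 \<le> 0 \<Longrightarrow> F X\<^sub>0 X\<^sub>1 Y\<^sub>1 Y\<^sub>1 = 0" using v(2)[of Y\<^sub>1 b\<^sub>1 Y\<^sub>1 b\<^sub>1] by simp
  show "F X\<^sub>0 X\<^sub>1 Y\<^sub>1 Y\<^sub>2 = 0" using v(2)[of Y\<^sub>1 b\<^sub>1 Y\<^sub>2 b\<^sub>2] 1 by simp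
  show "F X\<^sub>0 X\<^sub>1 Y\<^sub>2 Y\<^sub>2 = 0" using v(2)[of Y\<^sub>2 b\<^sub>2 Y\<^sub>2 b\<^sub>2] 1 by simp
  show "b\<^sub>0 + b\<^sub>1 \<le> 2 * a \<Longrightarrow> F X\<^sub>1 X\<^sub>1 Y\<^sub>0 Y\<^sub>1 = 0" using v(3)[of Y\<^sub>0 b\<^sub>0 Y\<^sub>1 b\<^sub>1] by simp
  show "b\<^sub>0 + b\<^sub>2 \<le> 2 * a \<Longrightarrow> F X\<^sub>1 X\<^sub>1 Y\<^sub>0 Y\<^sub>2 = 0" using v(3)[of Y\<^sub>0 b\<^sub>0 Y\<^sub>2 b\<^sub>2] by simp
  show "2 * b\<^sub>1 \<le> 2 * a \<Longrightarrow> F X\<^sub>1 X\<^sub>1 Y\<^sub>1 Y\<^sub>1 = 0" using v(3)[of Y\<^sub>1 b\<^sub>1 Y\<^sub>1 b\<^sub>1] by simp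
  show "F X\<^sub>1 X\<^sub>1 Y\<^sub>1 Y\<^sub>2 = 0" using v(3)[of Y\<^sub>1 b\<^sub>1 Y\<^sub>2 b\<^sub>2] 1 a by simp
  show "F X\<^sub>1 X\<^sub>1 Y\<^sub>2 Y\<^sub>2 = 0" using v(3)[of Y\<^sub>2 b\<^sub>2 Y\<^sub>2 b\<^sub>2] 1 a by simp
qed

lemma basis_nonzero: "X\<^sub>1 \<noteq> 0" "Y\<^sub>2 \<noteq> 0"
  using indep_x[of 0 1] indep_y[of 0 0 1] by auto

text \<open>By multilinearity it is enough to test on basis vectors. Transversality holds either
  because \<open>\<xi>\<close> is a nonzero multiple of \<open>X\<^sub>0\<close>, or because the
  determinant \<open>q * t - r * s\<close> keeps \<open>\<eta>\<close> from being a multiple of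
  \<open>y\<close>.\<close>

lemma degenerate_atI:
  assumes y: "y = s *s Y\<^sub>1 + t *s Y\<^sub>2" "s \<noteq> 0 \<or> t \<noteq> 0"
    and "F X\<^sub>0 X\<^sub>1 y y = 0" "F X\<^sub>1 X\<^sub>1 y Y\<^sub>0 = 0" "F X\<^sub>1 X\<^sub>1 y Y\<^sub>1 = 0" "F X\<^sub>1 X\<^sub>1 y Y\<^sub>2 = 0"
    and "F X\<^sub>0 \<xi> y y + 2 * F X\<^sub>0 X\<^sub>1 y \<eta> = 0" "F X\<^sub>1 \<xi> y y + 2 * F X\<^sub>1 X\<^sub>1 y \<eta> = 0"
    and "2 * F X\<^sub>1 \<xi> y Y\<^sub>0 + F X\<^sub>1 X\<^sub>1 Y\<^sub>0 \<eta> = 0" "2 * F X\<^sub>1 \<xi> y Y\<^sub>1 + F X\<^sub>1 X\<^sub>1 Y\<^sub>1 \<eta> = 0"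
      "2 * F X\<^sub>1 \<xi> y Y\<^sub>2 + F X\<^sub>1 X\<^sub>1 Y\<^sub>2 \<eta> = 0"
    and \<xi>\<eta>: "\<xi> = p *s X\<^sub>0" "\<eta> = q *s Y\<^sub>1 + r *s Y\<^sub>2" "p \<noteq> 0 \<or> q * t \<noteq> r * s"
  shows "degenerate_at X\<^sub>1 y \<xi> \<eta>"
proof -
  have "y \<noteq> 0" using y indep_y[of 0 s t] by auto
  moreover have "F X\<^sub>1 X\<^sub>1 y y = 0" using assms(5,6) y(1) by (simp add: linear)
  hence "F X\<^sub>1 z y y = 0" for z
    using span_x[of z] assms(3) sym_x[of X\<^sub>0 X\<^sub>1] by (auto simp: linear)
  moreover have "F X\<^sub>1 X\<^sub>1 y w = 0" for w
    using span_y[of w] assms(4-6) by (auto simp: linear)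
  moreover have "F z \<xi> y y + 2 * F X\<^sub>1 z y \<eta> = 0" for z
  proof -
    obtain s t where z: "z = s *s X\<^sub>0 + t *s X\<^sub>1" using span_x by blast
    have "F z \<xi> y y + 2 * F X\<^sub>1 z y \<eta> = s * (F X\<^sub>0 \<xi> y y + 2 * F X\<^sub>0 X\<^sub>1 y \<eta>) + t * (F X\<^sub>1 \<xi> y y + 2 * F X\<^sub>1 X\<^sub>1 y \<eta>)"
      using sym_x[of X\<^sub>0 X\<^sub>1] by (simp add: z linear algebra_simps)
    thus ?thesis using assms(7,8) by simp
  qed
  moreover have "2 * F X\<^sub>1 \<xi> y w + F X\<^sub>1 X\<^sub>1 w \<eta> = 0" for w
  proof -
    obtain r s t where w: "w = r *s Y\<^sub>0 + s *s Y\<^sub>1 + t *s Y\<^sub>2" using span_y by blast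
    have "2 * F X\<^sub>1 \<xi> y w + F X\<^sub>1 X\<^sub>1 w \<eta> = r * (2 * F X\<^sub>1 \<xi> y Y\<^sub>0 + F X\<^sub>1 X\<^sub>1 Y\<^sub>0 \<eta>) +
       s * (2 * F X\<^sub>1 \<xi> y Y\<^sub>1 + F X\<^sub>1 X\<^sub>1 Y\<^sub>1 \<eta>) + t * (2 * F X\<^sub>1 \<xi> y Y\<^sub>2 + F X\<^sub>1 X\<^sub>1 Y\<^sub>2 \<eta>)"
      by (simp add: w linear algebra_simps)
    thus ?thesis using assms(9-11) by simp
  qed
  moreover have "\<not> (\<exists>u v. \<xi> = u *s X\<^sub>1 \<and> \<eta> = v *s y)"
  proof
    assume "\<exists>u v. \<xi> = u *s X\<^sub>1 \<and> \<eta> = v *s y"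
    then obtain u v where uv: "\<xi> = u *s X\<^sub>1" "\<eta> = v *s y" by blast
    have "p *s X\<^sub>0 + (- u) *s X\<^sub>1 = 0" using uv(1) \<xi>\<eta>(1) by (simp add: vec_eq_iff)
    hence p: "p = 0" using indep_x by blast
    have "0 *s Y\<^sub>0 + (q - v * s) *s Y\<^sub>1 + (r - v * t) *s Y\<^sub>2 = \<eta> - v *s y"
      unfolding \<xi>\<eta>(2) y(1) by (simp add: vec_eq_iff algebra_simps)
    hence "q - v * s = 0 \<and> r - v * t = 0" using indep_y[of 0 "q - v * s" "r - v * t"] uv(2) by simp
    thus False using p \<xi>\<eta>(3) by (auto simp: mult_ac)
  qed
  ultimately show ?thesis
    using basis_nonzero by (simp add: degenerate_at_def)
qed

text \<open>If \<open>b\<^sub>1 \<ge> 0\<close>, the point is \<open>(X\<^sub>1, Y\<^sub>2)\<close>. If \<open>b\<^sub>1 < 0\<close>, the surface contains the curve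
  \<open>X\<^sub>1 \<times> \<langle>Y\<^sub>1, Y\<^sub>2\<rangle>\<close>, and it is singular where the linear form with coefficients
  \<open>p\<^sub>1\<close>, \<open>p\<^sub>2\<close> vanishes on it.\<close>

lemma ex_degenerate_at: "\<exists>x y \<xi> \<eta>. degenerate_at x y \<xi> \<eta>"
proof -
  have sy: "F x x' Y\<^sub>1 Y\<^sub>0 = F x x' Y\<^sub>0 Y\<^sub>1" "F x x' Y\<^sub>2 Y\<^sub>0 = F x x' Y\<^sub>0 Y\<^sub>2" "F x x' Y\<^sub>2 Y\<^sub>1 = F x x' Y\<^sub>1 Y\<^sub>2" for x x'
    by (rule sym_y)+
  have sx: "F X\<^sub>1 X\<^sub>0 y y' = F X\<^sub>0 X\<^sub>1 y y'" for y y' by (rule sym_x)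
  note c = coeff_eq_0
  have Y2: "Y\<^sub>2 = 0 *s Y\<^sub>1 + 1 *s Y\<^sub>2" by simp
  consider "b\<^sub>1 \<ge> 0" "a + b\<^sub>2 \<le> 0" | "b\<^sub>1 \<ge> 0" "a + b\<^sub>2 > 0"
    | "b\<^sub>1 < 0" "F X\<^sub>1 X\<^sub>1 Y\<^sub>0 Y\<^sub>2 \<noteq> 0"
    | "b\<^sub>1 < 0" "F X\<^sub>1 X\<^sub>1 Y\<^sub>0 Y\<^sub>2 = 0" by linarith
  thus ?thesis
  proof cases
    case 1
    \<comment> \<open>The coefficient of \<open>X\<^sub>0 X\<^sub>0 Y\<^sub>2 Y\<^sub>2\<close> has
      weight \<open>2 * (a + b\<^sub>2)\<close>, which is not positive, so \<open>X\<^sub>0\<close>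
      is a degenerate direction.\<close>
    have "F X\<^sub>1 X\<^sub>1 Y\<^sub>0 Y\<^sub>2 = 0" using 1 a b by (intro c) linarith
    hence "degenerate_at X\<^sub>1 Y\<^sub>2 (1 *s X\<^sub>0) (0 *s Y\<^sub>1 + 0 *s Y\<^sub>2)"
      using 1 by (intro degenerate_atI[OF Y2 _ _ _ _ _ _ _ _ _ _ refl refl]) (simp_all add: sx sy c)
    thus ?thesis by blast
  next
    case 2
    \<comment> \<open>Now \<open>a > - b\<^sub>2 = b\<^sub>0 + b\<^sub>1\<close>, so among the
      coefficients with \<open>X\<^sub>1 X\<^sub>1\<close> only that of
      \<open>Y\<^sub>0 Y\<^sub>0\<close> can survive, and \<open>Y\<^sub>1\<close> is a degenerate
      direction.\<close>
    have "F X\<^sub>1 X\<^sub>1 Y\<^sub>0 Y\<^sub>2 = 0" "F X\<^sub>1 X\<^sub>1 Y\<^sub>0 Y\<^sub>1 = 0" "F X\<^sub>1 X\<^sub>1 Y\<^sub>1 Y\<^sub>1 = 0"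
      using 2 a b by (intro c; linarith)+
    hence "degenerate_at X\<^sub>1 Y\<^sub>2 (0 *s X\<^sub>0) (1 *s Y\<^sub>1 + 0 *s Y\<^sub>2)"
      using 2 by (intro degenerate_atI[OF Y2 _ _ _ _ _ _ _ _ _ _ refl refl]) (simp_all add: sx sy c)
    thus ?thesis by blast
  next
    case 3
    \<comment> \<open>The nonzero coefficient has positive weight, so
      \<open>2 * a + b\<^sub>1 < 0\<close>; this removes every coefficient with
      \<open>X\<^sub>0 X\<^sub>0\<close> and no \<open>Y\<^sub>0\<close>.\<close>
    have *: "b\<^sub>0 + b\<^sub>2 > 2 * a" using c(9) 3(2) by linarith
    have z: "F X\<^sub>0 X\<^sub>0 Y\<^sub>1 Y\<^sub>1 = 0" "F X\<^sub>0 X\<^sub>0 Y\<^sub>1 Y\<^sub>2 = 0" "F X\<^sub>0 X\<^sub>0 Y\<^sub>2 Y\<^sub>2 = 0" "F X\<^sub>1 X\<^sub>1 Y\<^sub>1 Y\<^sub>1 = 0" "F X\<^sub>0 X\<^sub>1 Y\<^sub>1 Y\<^sub>1 = 0"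
      using * 3 a b by (intro c; linarith)+
    define p\<^sub>1 where "p\<^sub>1 = F X\<^sub>1 X\<^sub>1 Y\<^sub>0 Y\<^sub>1"
    define p\<^sub>2 where "p\<^sub>2 = F X\<^sub>1 X\<^sub>1 Y\<^sub>0 Y\<^sub>2"
    define y where "y = p\<^sub>2 *s Y\<^sub>1 + (- p\<^sub>1) *s Y\<^sub>2"
    define \<beta> where "\<beta> = F X\<^sub>0 X\<^sub>1 y Y\<^sub>0"
    have y: "F X\<^sub>0 X\<^sub>0 y y = 0" "F X\<^sub>0 X\<^sub>1 y y = 0" "F X\<^sub>1 X\<^sub>1 y Y\<^sub>1 = 0" "F X\<^sub>1 X\<^sub>1 y Y\<^sub>2 = 0"
      "F X\<^sub>0 X\<^sub>1 y Y\<^sub>1 = 0" "F X\<^sub>0 X\<^sub>1 y Y\<^sub>2 = 0"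
      unfolding y_def linear by (simp_all add: sy c z)
    have "F X\<^sub>1 X\<^sub>1 y Y\<^sub>0 = p\<^sub>2 * p\<^sub>1 + (- p\<^sub>1) * p\<^sub>2"
      unfolding y_def linear sy p\<^sub>1_def p\<^sub>2_def ..
    hence y': "F X\<^sub>1 X\<^sub>1 y Y\<^sub>0 = 0" by simp
    have \<beta>: "F X\<^sub>0 X\<^sub>1 y Y\<^sub>0 = \<beta>" and p\<^sub>2: "F X\<^sub>1 X\<^sub>1 Y\<^sub>0 Y\<^sub>2 = p\<^sub>2"
      by (simp_all add: \<beta>_def p\<^sub>2_def)
    have "p\<^sub>2 \<noteq> 0" using 3(2) by (simp add: p\<^sub>2_def)
    \<comment> \<open>The only condition that is not automatic is the one against
      \<open>Y\<^sub>0\<close>. It reads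
      \<open>2 * p\<^sub>2 * \<beta> - 2 * \<beta> * p\<^sub>2 = 0\<close> and dictates the
      component along \<open>Y\<^sub>2\<close>.\<close>
    hence "degenerate_at X\<^sub>1 y (p\<^sub>2 *s X\<^sub>0) (0 *s Y\<^sub>1 + (- 2 * \<beta>) *s Y\<^sub>2)"
      by (intro degenerate_atI[OF y_def _ _ _ _ _ _ _ _ _ _ refl refl])
        (simp_all add: linear minus sx sy c y y' \<beta> p\<^sub>2)
    thus ?thesis by blast
  next
    case 4
    define p\<^sub>1 where "p\<^sub>1 = F X\<^sub>1 X\<^sub>1 Y\<^sub>0 Y\<^sub>1"
    have z: "F X\<^sub>0 X\<^sub>1 Y\<^sub>1 Y\<^sub>1 = 0" "F X\<^sub>1 X\<^sub>1 Y\<^sub>1 Y\<^sub>1 = 0" using 4 a b by (intro c; linarith)+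
    show ?thesis
    proof (cases "p\<^sub>1 = 0")
      case True
      hence "degenerate_at X\<^sub>1 Y\<^sub>2 (0 *s X\<^sub>0) (1 *s Y\<^sub>1 + 0 *s Y\<^sub>2)"
        using 4 by (intro degenerate_atI[OF Y2 _ _ _ _ _ _ _ _ _ _ refl refl]) (simp_all add: sx sy c z p\<^sub>1_def)
      thus ?thesis by blast
    next
      case False
      \<comment> \<open>Positive weight of \<open>p\<^sub>1\<close> means
        \<open>- b\<^sub>2 > 2 * a\<close>, which kills the coefficient of
        \<open>X\<^sub>0 X\<^sub>0 Y\<^sub>2 Y\<^sub>2\<close>. The direction below is again chosen
        so that the condition against \<open>Y\<^sub>0\<close> cancels.\<close>
      hence "b\<^sub>0 + b\<^sub>1 > 2 * a" using c(8) unfolding p\<^sub>1_def by linarith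
      hence z': "F X\<^sub>0 X\<^sub>0 Y\<^sub>2 Y\<^sub>2 = 0" using a b by (intro c) linarith
      have p\<^sub>1: "F X\<^sub>1 X\<^sub>1 Y\<^sub>0 Y\<^sub>1 = p\<^sub>1" by (simp add: p\<^sub>1_def)
      have "degenerate_at X\<^sub>1 Y\<^sub>2 (p\<^sub>1 *s X\<^sub>0) ((- 2 * F X\<^sub>0 X\<^sub>1 Y\<^sub>2 Y\<^sub>0) *s Y\<^sub>1 + 0 *s Y\<^sub>2)"
        using 4 False
        by (intro degenerate_atI[OF Y2 _ _ _ _ _ _ _ _ _ _ refl refl])
          (simp_all add: linear minus sx sy c z z' p\<^sub>1)
      thus ?thesis by blast
    qed
  qed
qed

end

section \<open>Gaussian elimination with complete pivoting\<close>

text \<open>This replaces the Cartan decomposition in the proof of the Hilbert--Mumford criterion.\<close>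

definition pivoted :: "complex^'n^'n \<Rightarrow> bool" where
  "pivoted A \<longleftrightarrow> (\<exists>U L d. (\<forall>i j. norm (U $ i $ j) \<le> 2) \<and> (\<forall>i j. norm (L $ i $ j) \<le> 1) \<and>
     norm (det U) = 1 \<and> norm (det L) = 1 \<and> A ** U = (\<chi> i j. L $ i $ j * d j))"

text \<open>Lets pivots be moved to the leading positions. Undoing the row permutation in
  \<open>L\<close> and the column permutation in \<open>U\<close> changes determinants only by a
  sign.\<close>

lemma pivoted_permute:
  assumes p: "p permutes UNIV" and q: "q permutes UNIV" and "pivoted (\<chi> i j. A $ p i $ q j)"
  shows "pivoted A"
proof -
  obtain U L d where *: "\<And>i j. norm (U $ i $ j) \<le> 2" "\<And>i j. norm (L $ i $ j) \<le> 1"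
     "norm (det U) = 1" "norm (det L) = 1" "(\<chi> i j. A $ p i $ q j) ** U = (\<chi> i j. L $ i $ j * d j)"
    using assms(3) by (auto simp: pivoted_def)
  have det: "norm (det (\<chi> i. B $ Hilbert_Choice.inv r i)) = norm (det B)" if "r permutes UNIV" for r and B :: "complex^'n^'n"
    using det_permute_rows[OF permutes_inv[OF that], of B] by (simp add: norm_mult sign_def)
  have "A ** (\<chi> i. U $ Hilbert_Choice.inv q i) = (\<chi> i j. (\<chi> i. L $ Hilbert_Choice.inv p i) $ i $ j * d j)"
  proof -
    have "(A ** (\<chi> i. U $ Hilbert_Choice.inv q i)) $ r $ c = L $ Hilbert_Choice.inv p r $ c * d c" for r c
    proof -
      have "(A ** (\<chi> i. U $ Hilbert_Choice.inv q i)) $ r $ c = (\<Sum>k\<in>UNIV. A $ r $ k * U $ Hilbert_Choice.inv q k $ c)"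
        by (simp add: matrix_matrix_mult_def)
      also have "\<dots> = (\<Sum>k\<in>UNIV. A $ r $ q k * U $ Hilbert_Choice.inv q (q k) $ c)"
        by (rule sum.reindex_bij_betw[OF permutes_imp_bij[OF q], symmetric])
      also have "\<dots> = ((\<chi> i j. A $ p i $ q j) ** U) $ Hilbert_Choice.inv p r $ c"
        using p q by (simp add: matrix_matrix_mult_def permutes_inverses)
      finally show ?thesis using *(5) by simp
    qed
    thus ?thesis by (simp add: vec_eq_iff)
  qed
  thus ?thesis
    unfolding pivoted_def using * det[OF p] det[OF q]
    by (intro exI[of _ "\<chi> i. U $ Hilbert_Choice.inv q i"] exI[of _ "\<chi> i. L $ Hilbert_Choice.inv p i"] exI[of _ d]) simp
qed

text \<open>A zero pivot is included: then \<open>a\<close> is zero as well, and the convention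
  \<open>a / 0 = 0\<close> supplies the multiplier.\<close>

lemma ratioE:
  assumes "norm a \<le> norm (b :: complex)"
  obtains x where "a = x * b" "norm x \<le> 1"
proof (rule that)
  show "a = (a / b) * b" using assms by auto
  show "norm (a / b) \<le> 1" using assms by (auto simp: norm_divide divide_le_eq_1)
qed

lemma ex_max_norm:
  assumes "finite S" "S \<noteq> {}"
  obtains x where "x \<in> S" "\<And>y. y \<in> S \<Longrightarrow> norm (f y) \<le> norm (f x)"
proof -
  have "Max ((\<lambda>y. norm (f y)) ` S) \<in> (\<lambda>y. norm (f y)) ` S" using assms by (intro Max_in) auto
  then obtain x where x: "x \<in> S" "Max ((\<lambda>y. norm (f y)) ` S) = norm (f x)" by auto
  have "norm (f y) \<le> norm (f x)" if "y \<in> S" for y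
    using assms that unfolding x(2)[symmetric] by (intro Max_ge) auto
  thus ?thesis using x that by blast
qed

lemma pivoted_2: "pivoted (A :: complex^2^2)"
proof -
  obtain rs where rs: "\<And>y. norm (A $ fst y $ snd y) \<le> norm (A $ fst rs $ snd rs)"
    by (rule ex_max_norm[of UNIV "\<lambda>y. A $ fst y $ snd y"]) auto
  define p q where "p = Transposition.transpose 1 (fst rs)" and "q = Transposition.transpose 1 (snd rs)"
  define B where "B = (\<chi> i j. A $ p i $ q j)"
  have max: "norm (B $ i $ j) \<le> norm (B $ 1 $ 1)" for i j
    using rs[of "(p i, q j)"] by (simp add: B_def p_def q_def)
  obtain \<alpha> where \<alpha>: "B $ 1 $ 2 = \<alpha> * B $ 1 $ 1" "norm \<alpha> \<le> 1" using max by (rule ratioE)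
  obtain l where l: "B $ 2 $ 1 = l * B $ 1 $ 1" "norm l \<le> 1" using max by (rule ratioE)
  define U :: "complex^2^2" where "U = vector [vector [1, - \<alpha>], vector [0, 1]]"
  define L :: "complex^2^2" where "L = vector [vector [1, 0], vector [l, 1]]"
  define d :: "2 \<Rightarrow> complex" where "d i = (if i = 1 then B $ 1 $ 1 else B $ 2 $ 2 - l * \<alpha> * B $ 1 $ 1)" for i
  have "B ** U = (\<chi> i j. L $ i $ j * d j)"
    using \<alpha>(1) l(1) by (simp add: vec_eq_iff forall_2 matrix_matrix_mult_def sum_2 U_def L_def d_def)
  hence "pivoted B"
    unfolding pivoted_def using \<alpha>(2) l(2)
    by (intro exI[of _ U] exI[of _ L] exI[of _ d]) (simp add: det_2 forall_2 U_def L_def)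
  thus ?thesis
    unfolding B_def by (rule pivoted_permute[rotated 2]) (simp_all add: p_def q_def permutes_swap_id)
qed

lemma ex_permutes_3:
  assumes "a \<noteq> (b :: 3)"
  obtains p where "p permutes UNIV" "p 1 = a" "p 2 = b"
proof (rule that)
  let ?p = "Transposition.transpose (Transposition.transpose 1 a 2) b \<circ> Transposition.transpose 1 a"
  show "?p permutes UNIV" by (intro permutes_compose permutes_swap_id) auto
  show "?p 1 = a" "?p 2 = b" using assms by (auto simp: Transposition.transpose_def)
qed

lemma index3_distinct: "k + 1 \<noteq> k" "k + 2 \<noteq> k" "k + 2 \<noteq> k + 1" for k :: 3
  using exhaust_3[of k] by auto

lemma pivoted_3: "pivoted (A :: complex^3^3)"
proof -
  obtain rs where rs: "\<And>y. norm (A $ fst y $ snd y) \<le> norm (A $ fst rs $ snd rs)"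
    by (rule ex_max_norm[of UNIV "\<lambda>y. A $ fst y $ snd y"]) auto
  define r s where "r = fst rs" and "s = snd rs"
  \<comment> \<open>Schur complement of the first pivot. If that pivot is zero, maximality makes all
    of \<open>A\<close> zero, and \<open>S\<close> with it.\<close>
  define S where "S i j = A $ i $ j - A $ i $ s * (A $ r $ j / A $ r $ s)" for i j
  have "(- {r}) \<times> (- {s}) \<noteq> {}" using index3_distinct(1)[of r] index3_distinct(1)[of s] by blast
  then obtain rs' where rs': "rs' \<in> (- {r}) \<times> (- {s})"
     "\<And>y. y \<in> (- {r}) \<times> (- {s}) \<Longrightarrow> norm (S (fst y) (snd y)) \<le> norm (S (fst rs') (snd rs'))"
    using ex_max_norm[of "(- {r}) \<times> (- {s})" "\<lambda>y. S (fst y) (snd y)"] by (metis finite)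
  obtain p where p: "p permutes UNIV" "p 1 = r" "p 2 = fst rs'"
    using rs'(1) by (elim SigmaE) (metis ComplD ex_permutes_3 fst_conv singletonI)
  obtain q where q: "q permutes UNIV" "q 1 = s" "q 2 = snd rs'"
    using rs'(1) by (elim SigmaE) (metis ComplD ex_permutes_3 snd_conv singletonI)
  define B where "B = (\<chi> i j. A $ p i $ q j)"
  define T where "T i j = S (p i) (q j)" for i j
  have max: "norm (B $ i $ j) \<le> norm (B $ 1 $ 1)" for i j
    using rs[of "(p i, q j)"] by (simp add: B_def p q r_def s_def)
  have ne: "p i \<noteq> r" "q i \<noteq> s" if "i \<noteq> 1" for i
    using that p(2) q(2) permutes_inj[OF p(1)] permutes_inj[OF q(1)] by (metis injD)+
  have max': "norm (T i j) \<le> norm (T 2 2)" if "i \<noteq> 1" "j \<noteq> 1" for i j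
    using rs'(2)[of "(p i, q j)"] ne that by (simp add: T_def p q)
  obtain \<alpha> where \<alpha>: "B $ 1 $ 2 = \<alpha> * B $ 1 $ 1" "norm \<alpha> \<le> 1" using max by (rule ratioE)
  obtain \<gamma> where \<gamma>: "B $ 1 $ 3 = \<gamma> * B $ 1 $ 1" "norm \<gamma> \<le> 1" using max by (rule ratioE)
  obtain k where k: "B $ 2 $ 1 = k * B $ 1 $ 1" "norm k \<le> 1" using max by (rule ratioE)
  obtain l where l: "B $ 3 $ 1 = l * B $ 1 $ 1" "norm l \<le> 1" using max by (rule ratioE)
  obtain \<beta> where \<beta>: "T 2 3 = \<beta> * T 2 2" "norm \<beta> \<le> 1" by (rule ratioE[OF max'[of 2 3]]) auto
  obtain m where m: "T 3 2 = m * T 2 2" "norm m \<le> 1" by (rule ratioE[OF max'[of 3 2]]) auto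
  have T: "B $ i $ j = T i j + B $ i $ 1 * (B $ 1 $ j / B $ 1 $ 1)" for i j
    by (simp add: T_def S_def B_def p q)
  have T2: "B $ i $ 2 = T i 2 + B $ i $ 1 * \<alpha>" "B $ i $ 3 = T i 3 + B $ i $ 1 * \<gamma>" for i
    using T[of i 2] T[of i 3] \<alpha>(1) \<gamma>(1) max[of i 1] by auto
  \<comment> \<open>The inverse of the unit upper triangular matrix with entries
    \<open>\<alpha>\<close>, \<open>\<gamma>\<close>, \<open>\<beta>\<close>. Its corner entry is
    the origin of the bound 2 in \<open>pivoted\<close>.\<close>
  define U :: "complex^3^3" where
    "U = vector [vector [1, - \<alpha>, \<beta> * \<alpha> - \<gamma>], vector [0, 1, - \<beta>], vector [0, 0, 1]]"
  define L :: "complex^3^3" where "L = vector [vector [1, 0, 0], vector [k, 1, 0], vector [l, m, 1]]"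
  define d :: "3 \<Rightarrow> complex" where
    "d i = (if i = 1 then B $ 1 $ 1 else if i = 2 then T 2 2 else T 3 3 - m * \<beta> * T 2 2)" for i
  have "B ** U = (\<chi> i j. L $ i $ j * d j)"
    using \<alpha>(1) \<gamma>(1) k(1) l(1) \<beta>(1) m(1) T2[of 2] T2[of 3]
    by (simp add: vec_eq_iff forall_3 matrix_matrix_mult_def sum_3 U_def L_def d_def algebra_simps)
  moreover have "norm (\<beta> * \<alpha> - \<gamma>) \<le> 2"
    using norm_triangle_ineq4[of "\<beta> * \<alpha>" \<gamma>] mult_mono[OF \<beta>(2) \<alpha>(2)] \<gamma>(2) by (simp add: norm_mult)
  ultimately have "pivoted B"
    unfolding pivoted_def using \<alpha>(2) \<beta>(2) k(2) l(2) m(2)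
    by (intro exI[of _ U] exI[of _ L] exI[of _ d]) (simp add: det_3 forall_3 U_def L_def)
  thus ?thesis
    unfolding B_def by (rule pivoted_permute[OF p(1) q(1)])
qed

section \<open>Passing to an affine chart\<close>

text \<open>Velocity of a straight line in the chart, where the coordinate normalized to one does
  not move.\<close>

definition dir2 :: "2 \<Rightarrow> complex \<Rightarrow> complex^2" where
  "dir2 i u = (\<chi> j. if j = i then 0 else u)"

definition dir3 :: "3 \<Rightarrow> complex \<Rightarrow> complex \<Rightarrow> complex^3" where
  "dir3 k v w = (\<chi> l. if l = k then 0 else if l = k + 1 then v else w)"

lemma chart_line:
  "chart2 i (u + t * u') = chart2 i u + t *s dir2 i u'"
  "chart3 k (v + t * v') (w + t * w') = chart3 k v w + t *s dir3 k v' w'"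
  by (simp_all add: chart2_def chart3_def dir2_def dir3_def vec_eq_iff)

lemma dir_add:
  "dir2 i (u + u') = dir2 i u + dir2 i u'"
  "dir3 k (v + v') (w + w') = dir3 k v w + dir3 k v' w'"
  by (simp_all add: dir2_def dir3_def vec_eq_iff)

lemma index2_cases: "j = i \<or> j = i + 1" for i j :: 2
  using exhaust_2[of i] exhaust_2[of j] by auto

lemma index3_cases: "l = k \<or> l = k + 1 \<or> l = k + 2" for k l :: 3
  using exhaust_3[of k] exhaust_3[of l] by auto

lemma chart2_eq: "x $ i = 1 \<Longrightarrow> chart2 i (x $ (i + 1)) = x"
  using index2_cases[of _ i] by (auto simp: chart2_def vec_eq_iff)

lemma chart3_eq: "y $ k = 1 \<Longrightarrow> chart3 k (y $ (k + 1)) (y $ (k + 2)) = y"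
  using index3_cases[of _ k] index3_distinct[of k] by (auto simp: chart3_def vec_eq_iff)

lemma dir2_eq: "x $ i = 0 \<Longrightarrow> dir2 i (x $ (i + 1)) = x"
  using index2_cases[of _ i] by (auto simp: dir2_def vec_eq_iff)

lemma dir3_eq: "y $ k = 0 \<Longrightarrow> dir3 k (y $ (k + 1)) (y $ (k + 2)) = y"
  using index3_cases[of _ k] index3_distinct[of k] by (auto simp: dir3_def vec_eq_iff)

context polar22
begin

text \<open>Rescaling makes two coordinates one, and subtracting multiples of \<open>x'\<close> and
  \<open>y'\<close> makes the direction tangent to the chart. The correction terms vanish by
  singularity, so the degeneracy conditions are merely rescaled.\<close>

lemma degenerate_at_normalize:
  assumes "degenerate_at x y \<xi> \<eta>"
  obtains x' y' \<xi>' \<eta>' i k where "degenerate_at x' y' \<xi>' \<eta>'" "x' $ i = 1" "y' $ k = 1" "\<xi>' $ i = 0" "\<eta>' $ k = 0"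
proof -
  have xy: "x \<noteq> 0" "y \<noteq> 0" and S: "\<And>z. F x z y y = 0" "\<And>w. F x x y w = 0"
    and K: "\<And>z. F z \<xi> y y + 2 * F x z y \<eta> = 0" "\<And>w. 2 * F x \<xi> y w + F x x w \<eta> = 0"
    and N: "\<not> (\<exists>s t. \<xi> = s *s x \<and> \<eta> = t *s y)"
    using assms by (auto simp: degenerate_at_def)
  obtain i k where ik: "x $ i \<noteq> 0" "y $ k \<noteq> 0" using xy by (auto simp: vec_eq_iff)
  define \<sigma> \<tau> where "\<sigma> = inverse (x $ i)" and "\<tau> = inverse (y $ k)"
  have \<sigma>\<tau>: "\<sigma> * x $ i = 1" "\<tau> * y $ k = 1" "\<sigma> \<noteq> 0" "\<tau> \<noteq> 0" using ik by (simp_all add: \<sigma>_def \<tau>_def)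
  define x' y' where "x' = \<sigma> *s x" and "y' = \<tau> *s y"
  define \<xi>' \<eta>' where "\<xi>' = \<sigma> *s \<xi> - (\<sigma> * \<xi> $ i) *s x'" and "\<eta>' = \<tau> *s \<eta> - (\<tau> * \<eta> $ k) *s y'"
  have S': "F z x y y = 0" "F x x w y = 0" for z w
    using S(1)[of z] S(2)[of w] sym_x[of z x] sym_y[of x x w y] by simp_all
  have "x' \<noteq> 0" "y' \<noteq> 0" using xy \<sigma>\<tau> by (simp_all add: x'_def y'_def)
  moreover have "F x' z y' y' = 0" "F x' x' y' w = 0" for z w
    by (simp_all add: x'_def y'_def linear S)
  moreover have "F z \<xi>' y' y' + 2 * F x' z y' \<eta>' = 0" for z
  proof -
    have "F z \<xi>' y' y' + 2 * F x' z y' \<eta>' = \<sigma> * \<tau> * \<tau> * (F z \<xi> y y + 2 * F x z y \<eta>)"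
      by (simp add: x'_def y'_def \<xi>'_def \<eta>'_def linear diff S S' algebra_simps)
    thus ?thesis using K by simp
  qed
  moreover have "2 * F x' \<xi>' y' w + F x' x' w \<eta>' = 0" for w
  proof -
    have "2 * F x' \<xi>' y' w + F x' x' w \<eta>' = \<sigma> * \<sigma> * \<tau> * (2 * F x \<xi> y w + F x x w \<eta>)"
      by (simp add: x'_def y'_def \<xi>'_def \<eta>'_def linear diff S S' algebra_simps)
    thus ?thesis using K by simp
  qed
  moreover have "\<not> (\<exists>s t. \<xi>' = s *s x' \<and> \<eta>' = t *s y')"
  proof
    assume "\<exists>s t. \<xi>' = s *s x' \<and> \<eta>' = t *s y'"
    then obtain s t where st: "\<xi>' = s *s x'" "\<eta>' = t *s y'" by blast
    have "\<xi> = (s + \<sigma> * \<xi> $ i) *s x" "\<eta> = (t + \<tau> * \<eta> $ k) *s y"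
    proof -
      have *: "r *s u = r *s ((p + q) *s v)" if "r *s u - q *s (r *s v) = p *s (r *s v)"
        for p q r :: complex and u v :: "complex^'n"
        using that by (simp add: vec_eq_iff algebra_simps)
      have "\<sigma> *s \<xi> = \<sigma> *s ((s + \<sigma> * \<xi> $ i) *s x)"
        using st(1) unfolding \<xi>'_def x'_def by (rule *)
      moreover have "\<tau> *s \<eta> = \<tau> *s ((t + \<tau> * \<eta> $ k) *s y)"
        using st(2) unfolding \<eta>'_def y'_def by (rule *)
      ultimately show "\<xi> = (s + \<sigma> * \<xi> $ i) *s x" "\<eta> = (t + \<tau> * \<eta> $ k) *s y"
        using \<sigma>\<tau> by (auto simp only: vector_mul_lcancel)
    qed
    thus False using N by blast
  qed
  ultimately have "degenerate_at x' y' \<xi>' \<eta>'" by (simp add: degenerate_at_def)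
  moreover have "x' $ i = 1" "y' $ k = 1" using \<sigma>\<tau> by (simp_all add: x'_def y'_def)
  moreover from this have "\<xi>' $ i = 0" "\<eta>' $ k = 0" by (simp_all add: \<xi>'_def \<eta>'_def)
  ultimately show ?thesis by (rule that)
qed

lemma degenerate_at_imp_not_A1:
  assumes f: "f \<in> forms22" "\<And>x y. f x y = F x x y y"
    and "degenerate_at x y \<xi> \<eta>"
  shows "\<not> at_most_A1_singularities f"
proof
  assume A1: "at_most_A1_singularities f"
  obtain x y \<xi> \<eta> i k where deg: "degenerate_at x y \<xi> \<eta>"
    and n: "x $ i = 1" "y $ k = 1" "\<xi> $ i = 0" "\<eta> $ k = 0"
    using assms(3) by (rule degenerate_at_normalize)
  have S: "\<And>z. F x z y y = 0" "\<And>w. F x x y w = 0"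
    and K: "\<And>z. F z \<xi> y y + 2 * F x z y \<eta> = 0" "\<And>w. 2 * F x \<xi> y w + F x x w \<eta> = 0"
    and N: "\<not> (\<exists>s t. \<xi> = s *s x \<and> \<eta> = t *s y)"
    using deg by (auto simp: degenerate_at_def)
  define g where "g = dehom f i k"
  define P :: "complex^3" where "P = vector [x $ (i + 1), y $ (k + 1), y $ (k + 2)]"
  define D\<^sub>0 :: "complex^3" where "D\<^sub>0 = vector [\<xi> $ (i + 1), \<eta> $ (k + 1), \<eta> $ (k + 2)]"
  define z where "z D = dir2 i (D $ 1)" for D :: "complex^3"
  define w where "w D = dir3 k (D $ 2) (D $ 3)" for D :: "complex^3"
  have line: "line P D g = [:F x x y y, 2 * (F x (z D) y y + F x x y (w D)),
      F (z D) (z D) y y + 4 * F x (z D) y (w D) + F x x (w D) (w D),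
      2 * (F (z D) (z D) y (w D) + F x (z D) (w D) (w D)), F (z D) (z D) (w D) (w D):]" for D
  proof (rule line_eqI)
    fix t
    have "eval3 g (P + t *s D) = F (x + t *s z D) (x + t *s z D) (y + t *s w D) (y + t *s w D)"
      by (simp add: g_def dehom_eval[OF f(1)] f(2) chart_line P_def z_def w_def chart2_eq chart3_eq n)
    also have "\<dots> = poly [:F x x y y, 2 * (F x (z D) y y + F x x y (w D)),
      F (z D) (z D) y y + 4 * F x (z D) y (w D) + F x x (w D) (w D),
      2 * (F (z D) (z D) y (w D) + F x (z D) (w D) (w D)), F (z D) (z D) (w D) (w D):] t"
      using sym_x[of "z D" x] sym_y[of _ _ "w D" y] by (simp add: linear algebra_simps)
    finally show "eval3 g (P + t *s D) = poly [:F x x y y, 2 * (F x (z D) y y + F x x y (w D)),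
      F (z D) (z D) y y + 4 * F x (z D) y (w D) + F x x (w D) (w D),
      2 * (F (z D) (z D) y (w D) + F x (z D) (w D) (w D)), F (z D) (z D) (w D) (w D):] t" .
  qed
  have grad: "D $ 1 * eval3 (du g) P + D $ 2 * eval3 (dv g) P + D $ 3 * eval3 (dw g) P = 0" for D :: "complex^3"
    unfolding coeff_line_1[symmetric] line by (simp add: S)
  have sing: "singular_point g P"
    using grad[of "axis 1 1"] grad[of "axis 2 1"] grad[of "axis 3 1"] coeff_line_0[of P 0 g] S(1)[of x]
    by (simp add: singular_point_def axis_def line)
  have z0: "z D\<^sub>0 = \<xi>" and w0: "w D\<^sub>0 = \<eta>"
    using n by (simp_all add: z_def w_def D\<^sub>0_def dir2_eq dir3_eq)
  have "coeff (line P (D + D\<^sub>0) g) 2 = coeff (line P D g) 2" for D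
  \<comment> \<open>The equations \<open>K\<close> enter twice: with the vectors of \<open>D\<close>
    for the mixed terms, and with \<open>\<xi>\<close> and \<open>\<eta>\<close> themselves for the
    terms not involving \<open>D\<close>.\<close>
  proof -
    have zw: "z (D + D\<^sub>0) = z D + \<xi>" "w (D + D\<^sub>0) = w D + \<eta>"
      by (simp_all add: dir_add z_def w_def flip: z0 w0)
    have "coeff (line P (D + D\<^sub>0) g) 2 = coeff (line P D g) 2 + 2 * (F (z D) \<xi> y y + 2 * F x (z D) y \<eta>)
       + 2 * (2 * F x \<xi> y (w D) + F x x (w D) \<eta>) + (F \<xi> \<xi> y y + 2 * F x \<xi> y \<eta>) + (2 * F x \<xi> y \<eta> + F x x \<eta> \<eta>)"
      using sym_x[of \<xi> "z D"] sym_y[of _ _ \<eta> "w D"]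
      by (simp add: line zw linear numeral_2_eq_2)
    thus ?thesis using K by simp
  qed
  moreover have "A_type_singularity 1 g P"
    using A1 sing unfolding at_most_A1_singularities_def g_def by blast
  ultimately have "D\<^sub>0 = 0" using A1_kernel_trivial[OF _ sing] by blast
  hence "\<xi> = 0" "\<eta> = 0" using z0 w0 by (simp_all add: z_def w_def dir2_def dir3_def vec_eq_iff flip: z0 w0)
  hence "\<xi> = 0 *s x \<and> \<eta> = 0 *s y" by simp
  thus False using N by blast
qed

end

section \<open>A destabilizing one-parameter subgroup\<close>

lemma matrix_vector_mult_axis: "A *v axis k 1 = column k A" for A :: "complex^'n^'n"
  by (simp add: vec_eq_iff matrix_vector_mult_def column_def axis_def if_distrib[of "\<lambda>x. _ * x"] cong: if_cong)

lemma det_matrix_inv: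
  fixes M :: "complex^'n^'n"
  assumes "det M = 1"
  shows "det (matrix_inv M) = 1"
proof -
  have "invertible M" using assms by (simp add: invertible_det_nz)
  hence "M ** matrix_inv M = mat 1"
    by (simp add: invertible_def matrix_inv_def someI_ex[of "\<lambda>A'. M ** A' = mat 1 \<and> A' ** M = mat 1"])
  hence "det M * det (matrix_inv M) = 1" by (metis det_mul det_I)
  thus ?thesis using assms by simp
qed

context polar22
begin

lemma sum_x: "F (\<Sum>p\<in>S. u p *s a p) x' y y' = (\<Sum>p\<in>S. u p * F (a p) x' y y')"
  by (induction S rule: infinite_finite_induct) (simp_all add: linear)

lemma sum_y: "F x x' (\<Sum>p\<in>S. u p *s a p) y' = (\<Sum>p\<in>S. u p * F x x' (a p) y')"
  by (induction S rule: infinite_finite_induct) (simp_all add: linear)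

text \<open>Each x-argument costs a factor \<open>2 * 2\<close> and each y-argument a factor
  \<open>2 * 3\<close>, and \<open>4 * 4 * 6 * 6 = 576\<close>.\<close>

lemma norm_F_combination_le:
  fixes a :: "2 \<Rightarrow> complex^2" and b :: "3 \<Rightarrow> complex^3"
  assumes "\<And>p q r s. norm (F (a p) (a q) (b r) (b s)) \<le> C"
    and "\<And>p. norm (u p) \<le> 2" "\<And>p. norm (u' p) \<le> 2" "\<And>r. norm (v r) \<le> 2" "\<And>r. norm (v' r) \<le> 2"
  shows "norm (F (\<Sum>p\<in>UNIV. u p *s a p) (\<Sum>p\<in>UNIV. u' p *s a p)
     (\<Sum>r\<in>UNIV. v r *s b r) (\<Sum>r\<in>UNIV. v' r *s b r)) \<le> 576 * C"
    (is "norm (F ?x ?x' ?y ?y') \<le> _")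
proof -
  have comb: "norm (\<Sum>p\<in>UNIV. w p * z p) \<le> 2 * of_nat CARD('n) * K"
    if "\<And>p. norm (w p) \<le> 2" "\<And>p. norm (z p) \<le> K" for w z :: "'n::finite \<Rightarrow> complex" and K
  proof -
    have "norm (\<Sum>p\<in>UNIV. w p * z p) \<le> (\<Sum>p\<in>(UNIV :: 'n set). 2 * K)"
      by (rule order_trans[OF norm_sum sum_mono]) (use that in \<open>auto simp: norm_mult intro!: mult_mono\<close>)
    thus ?thesis by simp
  qed
  have 1: "norm (F ?x (a q) (b r) (b s)) \<le> 4 * C" for q r s
    unfolding sum_x using comb[of u "\<lambda>p. F (a p) (a q) (b r) (b s)" C] assms by simp
  have 2: "norm (F ?x ?x' (b r) (b s)) \<le> 16 * C" for r s
    unfolding sym_x[of ?x] sum_x[of u'] using comb[of u' "\<lambda>p. F (a p) ?x (b r) (b s)" "4 * C"] 1 assms(3)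
    by (simp add: sym_x[of _ ?x])
  have 3: "norm (F ?x ?x' ?y (b s)) \<le> 96 * C" for s
    unfolding sum_y using comb[of v "\<lambda>r. F ?x ?x' (b r) (b s)" "16 * C"] 2 assms(4) by simp
  show ?thesis
    unfolding sym_y[of _ _ ?y] sum_y[of _ _ v'] using comb[of v' "\<lambda>r. F ?x ?x' (b r) ?y" "96 * C"] 3 assms(5)
    by (simp add: sym_y[of _ _ _ ?y])
qed

lemma not_semistable_small:
  assumes f: "\<And>x y. f x y = F x x y y" and "\<not> semistable f" "\<epsilon> > 0"
  obtains A B where "det A = 1" "det B = 1"
    "\<And>i j k l. norm (F (column i A) (column j A) (column k B) (column l B)) \<le> \<epsilon>"
proof -
  \<comment> \<open>The finitely many points used by polarization at unit vectors; bounding a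
    function on them gives an open neighbourhood of zero for pointwise convergence.\<close>
  define T :: "((complex^2) \<times> (complex^3)) set" where
    "T = ((\<lambda>(i, j). axis i 1 + axis j 1) ` UNIV \<union> (\<lambda>(i, j). axis i 1 - axis j 1) ` UNIV) \<times>
      ((\<lambda>(i, j). axis i 1 + axis j 1) ` UNIV \<union> (\<lambda>(i, j). axis i 1 - axis j 1) ` UNIV)"
  define W :: "(complex^2 \<Rightarrow> complex^3 \<Rightarrow> complex) set" where
    "W = (\<Inter>p\<in>T. {h. norm (h (fst p) (snd p)) < \<epsilon>})"
  have "finite T" unfolding T_def by (intro finite_cartesian_product finite_UnI finite_imageI finite)
  have "open W"
  proof -
    have "continuous_on UNIV (\<lambda>h :: complex^2 \<Rightarrow> complex^3 \<Rightarrow> complex. h x y)" for x y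
      by (rule continuous_on_product_then_coordinatewise) (rule continuous_on_product_coordinates)
    hence "open {h :: complex^2 \<Rightarrow> complex^3 \<Rightarrow> complex. norm (h x y) < \<epsilon>}" for x y
      by (intro open_Collect_less continuous_on_norm continuous_on_const)
    thus ?thesis unfolding W_def using \<open>finite T\<close> by (intro open_INT) auto
  qed
  moreover have "(\<lambda>x y. 0) \<in> W" using \<open>\<epsilon> > 0\<close> by (simp add: W_def)
  ultimately have "W \<inter> SL_orbit f \<noteq> {}"
    using assms(2) open_Int_closure_eq_empty[of W "SL_orbit f"] by (auto simp: semistable_def)
  then obtain A B where AB: "det A = 1" "det B = 1" "act A B f \<in> W" by (auto simp: SL_orbit_def)
  define A' B' where "A' = matrix_inv A" and "B' = matrix_inv B"
  have small: "norm (F (A' *v x) (A' *v x) (B' *v y) (B' *v y)) < \<epsilon>" if "(x, y) \<in> T" for x y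
    using AB(3) that by (force simp: W_def act_def f A'_def B'_def)
  have "norm (F (column i A') (column j A') (column k B') (column l B')) \<le> \<epsilon>" for i j k l
  proof -
    define x x' where "x = A' *v axis i 1" and "x' = A' *v axis j 1"
    define y y' where "y = B' *v axis k 1" and "y' = B' *v axis l 1"
    have T: "(axis i 1 + axis j 1, axis k 1 + axis l 1) \<in> T" "(axis i 1 - axis j 1, axis k 1 + axis l 1) \<in> T"
      "(axis i 1 + axis j 1, axis k 1 - axis l 1) \<in> T" "(axis i 1 - axis j 1, axis k 1 - axis l 1) \<in> T"
      unfolding T_def by (auto simp: image_iff)
    have "norm (16 * F x x' y y') \<le> \<epsilon> + \<epsilon> + \<epsilon> + \<epsilon>"
      unfolding polarization
      using small[OF T(1)] small[OF T(2)] small[OF T(3)] small[OF T(4)]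
      unfolding matrix_vector_right_distrib matrix_vector_mult_diff_distrib x_def y_def x'_def y'_def
      by (intro norm_triangle_le norm_triangle_le_diff add_mono) auto
    thus ?thesis
      using \<open>\<epsilon> > 0\<close> by (simp add: norm_mult x_def x'_def y_def y'_def matrix_vector_mult_axis)
  qed
  thus ?thesis
    using that[of A' B'] det_matrix_inv[OF AB(1)] det_matrix_inv[OF AB(2)] by (simp add: A'_def B'_def)
qed

end

text \<open>Determinants are compared in \<open>A U = L D\<close> with \<open>D\<close> diagonal.
  Taking logarithms, this becomes the vanishing of the sum of the weights.\<close>

lemma pivoted_prod_norm:
  fixes A :: "complex^'n^'n"
  assumes "det A = 1" "norm (det U) = 1" "norm (det L) = 1" "A ** U = (\<chi> i j. L $ i $ j * d j)"
  shows "(\<Prod>i\<in>UNIV. norm (d i)) = 1"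
proof -
  define E :: "complex^'n^'n" where "E = (\<chi> i j. if i = j then d i else 0)"
  have "L ** E = (\<chi> i j. L $ i $ j * d j)"
    by (simp add: matrix_matrix_mult_def E_def vec_eq_iff if_distrib[of "\<lambda>x. _ * x"] cong: if_cong)
  hence "det L * det E = det A * det U"
    using assms(4) by (metis det_mul)
  moreover have "det E = prod d UNIV" by (subst det_diagonal) (simp_all add: E_def)
  ultimately have "norm (det L * prod d UNIV) = norm (det A * det U)" by simp
  thus ?thesis using assms by (simp add: norm_mult prod_norm)
qed

lemma column_mult: "column i (A ** U) = (\<Sum>p\<in>UNIV. U $ p $ i *s column p A)" for A U :: "complex^'n^'n"
  by (simp add: vec_eq_iff column_def matrix_matrix_mult_def mult.commute)

text \<open>Columns of \<open>A ** U\<close> are the columns of \<open>L\<close> scaled by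
  \<open>d\<close>, so boundedness of \<open>U\<close> carries smallness over to the scaled basis;
  dividing \<open>\<epsilon>\<close> by 576 pays for the change of columns.\<close>

lemma (in polar22) not_semistable_pivoted:
  assumes f: "\<And>x y. f x y = F x x y y" and "\<not> semistable f" "\<epsilon> > 0"
  obtains L :: "complex^2^2" and M :: "complex^3^3" and d :: "2 \<Rightarrow> complex" and e :: "3 \<Rightarrow> complex" where
    "\<And>i j. norm (L $ i $ j) \<le> 1" "\<And>i j. norm (M $ i $ j) \<le> 1" "norm (det L) = 1" "norm (det M) = 1"
    "(\<Prod>i\<in>UNIV. norm (d i)) = 1" "(\<Prod>i\<in>UNIV. norm (e i)) = 1"
    "\<And>i j k l. norm (d i * d j * e k * e l) * norm (F (column i L) (column j L) (column k M) (column l M)) \<le> \<epsilon>"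
proof -
  have "\<epsilon> / 576 > 0" using assms by simp
  then obtain A B where A: "det A = 1" "det B = 1"
    "\<And>i j k l. norm (F (column i A) (column j A) (column k B) (column l B)) \<le> \<epsilon> / 576"
    using not_semistable_small[OF f assms(2)] by metis
  obtain U L d where L: "\<And>i j. norm (U $ i $ j) \<le> 2" "\<And>i j. norm (L $ i $ j) \<le> 1"
     "norm (det U) = 1" "norm (det L) = 1" "A ** U = (\<chi> i j. L $ i $ j * d j)"
    using pivoted_2[of A] by (auto simp: pivoted_def)
  obtain V M e where M: "\<And>i j. norm (V $ i $ j) \<le> 2" "\<And>i j. norm (M $ i $ j) \<le> 1"
     "norm (det V) = 1" "norm (det M) = 1" "B ** V = (\<chi> i j. M $ i $ j * e j)"
    using pivoted_3[of B] by (auto simp: pivoted_def)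
  have col: "column i (\<chi> i j. N $ i $ j * c j) = c i *s column i N" for N :: "complex^'m^'m" and c i
    by (simp add: vec_eq_iff column_def mult.commute)
  have "norm (d i * d j * e k * e l) * norm (F (column i L) (column j L) (column k M) (column l M)) \<le> \<epsilon>" for i j k l
  proof -
    have "norm (F (column i (A ** U)) (column j (A ** U)) (column k (B ** V)) (column l (B ** V))) \<le> 576 * (\<epsilon> / 576)"
      unfolding column_mult by (rule norm_F_combination_le) (use A L M in auto)
    thus ?thesis unfolding L M col by (simp add: linear norm_mult ac_simps)
  qed
  moreover have "(\<Prod>i\<in>UNIV. norm (d i)) = 1" by (rule pivoted_prod_norm[OF A(1) L(3-5)])
  moreover have "(\<Prod>i\<in>UNIV. norm (e i)) = 1" by (rule pivoted_prod_norm[OF A(2) M(3-5)])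
  ultimately show ?thesis using L M that by blast
qed

lemma norm_matrix_le:
  fixes L :: "complex^'n^'n"
  assumes "\<And>i j. norm (L $ i $ j) \<le> 1"
  shows "norm L \<le> real CARD('n) * real CARD('n)"
proof -
  have "norm (L $ i) \<le> real CARD('n)" for i
  proof -
    have "norm (L $ i) \<le> (\<Sum>j\<in>UNIV. norm (L $ i $ j))" unfolding norm_vec_def by (rule L2_set_le_sum) simp
    also have "\<dots> \<le> (\<Sum>j\<in>(UNIV :: 'n set). 1)" using assms by (intro sum_mono)
    finally show ?thesis by simp
  qed
  hence "(\<Sum>i\<in>UNIV. norm (L $ i)) \<le> (\<Sum>i\<in>(UNIV :: 'n set). real CARD('n))" by (intro sum_mono)
  moreover have "norm L \<le> (\<Sum>i\<in>UNIV. norm (L $ i))" unfolding norm_vec_def[of L] by (rule L2_set_le_sum) simp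
  ultimately show ?thesis by simp
qed

lemma (in polar22) destabilizing_weights:
  assumes f: "\<And>x y. f x y = F x x y y" and "\<not> semistable f"
    and F: "\<And>x x' y y'. F x x' y y' =
       (\<Sum>i\<in>UNIV. \<Sum>j\<in>UNIV. \<Sum>k\<in>UNIV. \<Sum>l\<in>UNIV. c i j k l * (x $ i * x' $ j) * (y $ k * y' $ l))"
  obtains L :: "complex^2^2" and M :: "complex^3^3" and a :: "2 \<Rightarrow> real" and b :: "3 \<Rightarrow> real"
    where "det L \<noteq> 0" "det M \<noteq> 0" "sum a UNIV = 0" "sum b UNIV = 0"
    "\<And>i j k l. a i + a j + b k + b l \<le> 0 \<Longrightarrow> F (column i L) (column j L) (column k M) (column l M) = 0"
proof -
  define Q where "Q n L M d e \<longleftrightarrow> (\<forall>i j. norm (L $ i $ j) \<le> 1) \<and> (\<forall>i j. norm (M $ i $ j) \<le> 1) \<and>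
      norm (det L) = 1 \<and> norm (det M) = 1 \<and> (\<Prod>i\<in>UNIV. norm (d i)) = 1 \<and> (\<Prod>i\<in>UNIV. norm (e i)) = 1 \<and>
      (\<forall>i j k l. norm (d i * d j * e k * e l) * norm (F (column i L) (column j L) (column k M) (column l M))
        \<le> inverse (real (Suc n)))"
    for n and L :: "complex^2^2" and M :: "complex^3^3" and d e :: "_ \<Rightarrow> complex"
  have "\<exists>L M d e. Q n L M d e" for n
  proof -
    have pos: "inverse (real (Suc n)) > 0" by simp
    show ?thesis
      unfolding Q_def by (rule not_semistable_pivoted[OF f assms(2) pos]) blast
  qed
  then obtain L M d e where Q: "\<And>n. Q n (L n) (M n) (d n) (e n)" by metis
  have *: "\<And>n i j. norm (L n $ i $ j) \<le> 1" "\<And>n i j. norm (M n $ i $ j) \<le> 1"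
    "\<And>n. norm (det (L n)) = 1" "\<And>n. norm (det (M n)) = 1"
    "\<And>n. (\<Prod>i\<in>UNIV. norm (d n i)) = 1" "\<And>n. (\<Prod>i\<in>UNIV. norm (e n i)) = 1"
    and small: "\<And>n i j k l. norm (d n i * d n j * e n k * e n l) *
      norm (F (column i (L n)) (column j (L n)) (column k (M n)) (column l (M n))) \<le> inverse (real (Suc n))"
    using Q unfolding Q_def by blast+
  have "bounded (range (\<lambda>n. (L n, M n)))"
  proof -
    \<comment> \<open>The bound is \<open>2 * 2 + 3 * 3\<close>.\<close>
    have "norm (L n, M n) \<le> 13" for n
      using order_trans[OF norm_Pair_le add_mono[OF norm_matrix_le[OF *(1)] norm_matrix_le[OF *(2)]]] by simp
    thus ?thesis by (intro boundedI[of _ 13]) auto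
  qed
  then obtain LM r where r: "strict_mono (r :: nat \<Rightarrow> nat)" and "((\<lambda>n. (L n, M n)) \<circ> r) \<longlonglongrightarrow> LM"
    using bounded_imp_convergent_subsequence by blast
  from tendsto_fst[OF this(2)] tendsto_snd[OF this(2)]
  obtain L' M' where lim: "(\<lambda>n. L (r n)) \<longlonglongrightarrow> L'" "(\<lambda>n. M (r n)) \<longlonglongrightarrow> M'" by (auto simp: o_def)
  have entries: "(\<lambda>n. L (r n) $ i $ j) \<longlonglongrightarrow> L' $ i $ j" "(\<lambda>n. M (r n) $ k $ l) \<longlonglongrightarrow> M' $ k $ l" for i j k l
    by (intro tendsto_vec_nth lim)+
  have "(\<lambda>n. norm (det (L (r n)))) \<longlonglongrightarrow> norm (det L')"
    unfolding det_2 by (intro tendsto_norm tendsto_diff tendsto_mult entries)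
  hence "1 = norm (det L')" by (simp only: *(3) LIMSEQ_const_iff)
  hence detL: "det L' \<noteq> 0" by (metis norm_zero zero_neq_one)
  have "(\<lambda>n. norm (det (M (r n)))) \<longlonglongrightarrow> norm (det M')"
    unfolding det_3 by (intro tendsto_norm tendsto_add tendsto_diff tendsto_mult entries)
  hence "1 = norm (det M')" by (simp only: *(4) LIMSEQ_const_iff)
  hence detM: "det M' \<noteq> 0" by (metis norm_zero zero_neq_one)
  define \<phi> where "\<phi> L M i j k l = F (column i L) (column j L) (column k M) (column l M)"
    for L :: "complex^2^2" and M :: "complex^3^3" and i j k l
  \<comment> \<open>A coefficient that is nonzero in the limit eventually exceeds
    \<open>1 / Suc (r n)\<close>, which still bounds its product with the scaling factor; the factor
    must therefore be below one.\<close>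
  have "\<forall>\<^sub>F n in sequentially. \<phi> L' M' i j k l \<noteq> 0 \<longrightarrow>
     norm (d (r n) i * d (r n) j * e (r n) k * e (r n) l) < 1" for i j k l
  proof (cases "\<phi> L' M' i j k l = 0")
    case False
    have "(\<lambda>n. inverse (real (Suc (r n)))) \<longlonglongrightarrow> 0"
      using LIMSEQ_subseq_LIMSEQ[OF LIMSEQ_inverse_real_of_nat r] by (simp add: o_def)
    moreover have "(\<lambda>n. norm (\<phi> (L (r n)) (M (r n)) i j k l)) \<longlonglongrightarrow> norm (\<phi> L' M' i j k l)"
      unfolding \<phi>_def F column_def by (simp, intro tendsto_norm tendsto_sum tendsto_mult tendsto_const entries)
    ultimately have "(\<lambda>n. norm (\<phi> (L (r n)) (M (r n)) i j k l) - inverse (real (Suc (r n)))) \<longlonglongrightarrow> norm (\<phi> L' M' i j k l) - 0"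
      by (intro tendsto_diff)
    moreover have "0 < norm (\<phi> L' M' i j k l) - 0" using False by simp
    ultimately have "\<forall>\<^sub>F n in sequentially. 0 < norm (\<phi> (L (r n)) (M (r n)) i j k l) - inverse (real (Suc (r n)))"
      by (rule order_tendstoD(1))
    thus ?thesis
    proof eventually_elim
      case (elim n)
      have "norm (d (r n) i * d (r n) j * e (r n) k * e (r n) l) * norm (\<phi> (L (r n)) (M (r n)) i j k l)
          < 1 * norm (\<phi> (L (r n)) (M (r n)) i j k l)"
        using small[of "r n" i j k l] elim by (simp only: \<phi>_def)
      thus ?case by (metis mult_less_cancel_right_disj norm_ge_zero not_less)
    qed
  qed simp
  hence "\<forall>\<^sub>F n in sequentially. \<forall>i j k l. \<phi> L' M' i j k l \<noteq> 0 \<longrightarrow>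
     norm (d (r n) i * d (r n) j * e (r n) k * e (r n) l) < 1"
    by (intro eventually_all_finite)
  then obtain n where n: "\<And>i j k l. \<phi> L' M' i j k l \<noteq> 0 \<Longrightarrow>
     norm (d (r n) i * d (r n) j * e (r n) k * e (r n) l) < 1"
    using eventually_happens'[OF sequentially_bot] by blast
  \<comment> \<open>Finitely many index tuples allow one \<open>n\<close> for all of them. The minus
    sign turns a scaling factor below one into a positive weight.\<close>
  define a b where "a i = - ln (norm (d (r n) i))" and "b k = - ln (norm (e (r n) k))" for i k
  have nz: "norm (d (r n) i) > 0" "norm (e (r n) k) > 0" for i k
    using *(5)[of "r n"] *(6)[of "r n"] by (metis UNIV_I finite norm_eq_zero prod_zero zero_less_norm_iff zero_neq_one)+
  have ab: "sum a UNIV = 0" "sum b UNIV = 0"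
    using ln_prod[of UNIV "\<lambda>i. norm (d (r n) i)"] ln_prod[of UNIV "\<lambda>i. norm (e (r n) i)"] nz *(5,6)[of "r n"]
    by (simp_all add: a_def b_def sum_negf)
  have "\<phi> L' M' i j k l = 0" if "a i + a j + b k + b l \<le> 0" for i j k l
  proof (rule ccontr)
    assume "\<phi> L' M' i j k l \<noteq> 0"
    from n[OF this] have "ln (norm (d (r n) i * d (r n) j * e (r n) k * e (r n) l)) < 0"
      using nz by (intro ln_less_zero) auto
    moreover have "ln (norm (d (r n) i * d (r n) j * e (r n) k * e (r n) l)) = - (a i + a j + b k + b l)"
      using nz by (simp add: norm_mult ln_mult_pos a_def b_def)
    ultimately show False using that by simp
  qed
  thus ?thesis using that detL detM ab by (simp add: \<phi>_def)
qed

section \<open>Bases from columns, ordering of the weights, and the conclusion\<close>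

lemma columns_basis:
  fixes L :: "complex^'n^'n"
  assumes "det L \<noteq> 0"
  shows "\<exists>u. z = (\<Sum>i\<in>UNIV. u i *s column i L)"
    and "(\<Sum>i\<in>UNIV. u i *s column i L) = 0 \<Longrightarrow> u i = 0"
proof -
  have "invertible L" using assms by (simp add: invertible_det_nz)
  then obtain L' where L': "L ** L' = mat 1" "L' ** L = mat 1" by (auto simp: invertible_def)
  have "z = L *v (L' *v z)" by (simp add: matrix_vector_mul_assoc L')
  thus "\<exists>u. z = (\<Sum>i\<in>UNIV. u i *s column i L)" unfolding matrix_mult_sum by blast
  assume *: "(\<Sum>i\<in>UNIV. u i *s column i L) = 0"
  define v where "v = (\<chi> i. u i)"
  have "L *v v = 0" using * by (simp add: matrix_mult_sum v_def)
  hence "L' *v (L *v v) = 0" by simp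
  hence "v = 0" by (simp add: matrix_vector_mul_assoc L')
  thus "u i = 0" by (simp add: v_def vec_eq_iff)
qed

lemma sum_UNIV_3:
  assumes "distinct [k\<^sub>0, k\<^sub>1, k\<^sub>2 :: 3]"
  shows "sum g UNIV = g k\<^sub>0 + g k\<^sub>1 + (g k\<^sub>2 :: 'a :: comm_monoid_add)"
proof -
  have "card {k\<^sub>0, k\<^sub>1, k\<^sub>2} = CARD(3)" using assms by simp
  hence "UNIV = {k\<^sub>0, k\<^sub>1, k\<^sub>2}" by (metis card_subset_eq finite subset_UNIV)
  hence "sum g UNIV = sum g {k\<^sub>0, k\<^sub>1, k\<^sub>2}" by (rule arg_cong)
  thus ?thesis using assms by (simp add: add.assoc)
qed

lemma sum_UNIV_2:
  assumes "i\<^sub>0 \<noteq> (i\<^sub>1 :: 2)"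
  shows "sum g UNIV = g i\<^sub>0 + (g i\<^sub>1 :: 'a :: comm_monoid_add)"
proof -
  have "card {i\<^sub>0, i\<^sub>1} = CARD(2)" using assms by simp
  hence "UNIV = {i\<^sub>0, i\<^sub>1}" by (metis card_subset_eq finite subset_UNIV)
  hence "sum g UNIV = sum g {i\<^sub>0, i\<^sub>1}" by (rule arg_cong)
  thus ?thesis using assms by simp
qed

lemma sorted_indices_3:
  obtains k\<^sub>0 k\<^sub>1 k\<^sub>2 :: 3 where "distinct [k\<^sub>0, k\<^sub>1, k\<^sub>2]" "(b k\<^sub>0 :: real) \<ge> b k\<^sub>1" "b k\<^sub>1 \<ge> b k\<^sub>2"
proof -
  have "\<exists>k\<^sub>0 k\<^sub>1 k\<^sub>2. {k\<^sub>0, k\<^sub>1, k\<^sub>2} \<subseteq> {1, 2, 3 :: 3} \<and> distinct [k\<^sub>0, k\<^sub>1, k\<^sub>2] \<and> b k\<^sub>0 \<ge> b k\<^sub>1 \<and> b k\<^sub>1 \<ge> b k\<^sub>2"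
  proof -
    have d: "distinct [1, 2, 3 :: 3]" "distinct [1, 3, 2 :: 3]" "distinct [2, 1, 3 :: 3]" "distinct [2, 3, 1 :: 3]"
      "distinct [3, 1, 2 :: 3]" "distinct [3, 2, 1 :: 3]" by simp_all
    show ?thesis
      using d linear[of "b 1" "b 2"] linear[of "b 1" "b 3"] linear[of "b 2" "b 3"] by blast
  qed
  thus ?thesis using that by blast
qed

theorem lemma3p1:
  fixes f :: "complex^2 \<Rightarrow> complex^3 \<Rightarrow> complex"
  assumes "f \<in> forms22" and "f \<noteq> (\<lambda>x y. 0)"
    and "at_most_A1_singularities f"
  shows "semistable f"
proof (rule ccontr)
  assume unstable: "\<not> semistable f"
  obtain F c where "polar22 F" and f: "\<And>x y. f x y = F x x y y"
    and F: "\<And>x x' y y'. F x x' y y' =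
       (\<Sum>i\<in>UNIV. \<Sum>j\<in>UNIV. \<Sum>k\<in>UNIV. \<Sum>l\<in>UNIV. c i j k l * (x $ i * x' $ j) * (y $ k * y' $ l))"
    by (rule forms22_polar[OF assms(1)]) blast
  interpret polar22 F by fact
  obtain L :: "complex^2^2" and M :: "complex^3^3" and a b :: "_ \<Rightarrow> real" where LM: "det L \<noteq> 0" "det M \<noteq> 0" "sum a UNIV = 0" "sum b UNIV = 0"
    and vanish: "\<And>i j k l. a i + a j + b k + b l \<le> 0 \<Longrightarrow> F (column i L) (column j L) (column k M) (column l M) = 0"
    by (rule destabilizing_weights[OF f unstable F]) blast
  obtain i\<^sub>0 i\<^sub>1 where i: "i\<^sub>0 \<noteq> i\<^sub>1" "a i\<^sub>0 \<ge> a i\<^sub>1" by (metis linorder_linear zero_neq_one)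
  obtain k\<^sub>0 k\<^sub>1 k\<^sub>2 where k: "distinct [k\<^sub>0, k\<^sub>1, k\<^sub>2]" "b k\<^sub>0 \<ge> b k\<^sub>1" "b k\<^sub>1 \<ge> b k\<^sub>2"
    by (rule sorted_indices_3)
  have a: "a i\<^sub>1 = - a i\<^sub>0" using LM(3) by (simp add: sum_UNIV_2[OF i(1)])
  \<comment> \<open>The columns are listed by decreasing weight. The two x-weights sum to zero,
    hence are opposite, and the larger one is nonnegative.\<close>
  interpret destabilized F "column i\<^sub>0 L" "column i\<^sub>1 L" "column k\<^sub>0 M" "column k\<^sub>1 M" "column k\<^sub>2 M" "a i\<^sub>0" "b k\<^sub>0" "b k\<^sub>1" "b k\<^sub>2"
  proof unfold_locales
    fix z :: "complex^2" and w :: "complex^3" and r s t :: complex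
    show "\<exists>s t. z = s *s column i\<^sub>0 L + t *s column i\<^sub>1 L"
      using columns_basis(1)[OF LM(1), of z] unfolding sum_UNIV_2[OF i(1)] by blast
    show "\<exists>r s t. w = r *s column k\<^sub>0 M + s *s column k\<^sub>1 M + t *s column k\<^sub>2 M"
      using columns_basis(1)[OF LM(2), of w] unfolding sum_UNIV_3[OF k(1)] by blast
    show "s = 0 \<and> t = 0" if "s *s column i\<^sub>0 L + t *s column i\<^sub>1 L = 0"
      using columns_basis(2)[OF LM(1), of "\<lambda>i. if i = i\<^sub>0 then s else t"] that i
      unfolding sum_UNIV_2[OF i(1)] by (metis (full_types))
    show "r = 0 \<and> s = 0 \<and> t = 0" if "r *s column k\<^sub>0 M + s *s column k\<^sub>1 M + t *s column k\<^sub>2 M = 0"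
    proof -
      let ?u = "\<lambda>k. if k = k\<^sub>0 then r else if k = k\<^sub>1 then s else t"
      have "(\<Sum>k\<in>UNIV. ?u k *s column k M) = 0" using that k(1) by (auto simp: sum_UNIV_3[OF k(1)])
      hence "?u k\<^sub>0 = 0" "?u k\<^sub>1 = 0" "?u k\<^sub>2 = 0" by (rule columns_basis(2)[OF LM(2)])+
      thus ?thesis using k(1) by auto
    qed
    show "0 \<le> a i\<^sub>0" using i a by simp
    show "b k\<^sub>0 + b k\<^sub>1 + b k\<^sub>2 = 0" using LM(4) by (simp add: sum_UNIV_3[OF k(1)])
  qed (use k vanish a in auto)
  show False
    using ex_degenerate_at degenerate_at_imp_not_A1[OF assms(1) f] assms(3) by blast
qed

end
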